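(* Assume: (A1) $X\subset\mathbb{R}^d$ is a nonempty closed convex set onto which the projection can be easily computed; (A2) $f:\mathbb{R}^d\to\mathbb{R}$, $f(\mathbf{x}):=\mathbb{E}[F(\mathbf{x},\boldsymbol{\xi})]$, is well defined, where $F(\cdot,\boldsymbol{\xi})$ is continuously differentiable for almost every $\boldsymbol{\xi}\in\Xi$; (A3) $h_{n+1,i}\ge h_{n,i}$ almost surely for all $n\in\mathbb{N}$ and all $i=1,\dots,d$; (A4) for all $i=1,\dots,d$ there is a positive number $B_i$ with $\sup\{\mathbb{E}[h_{n,i}]:n\in\mathbb{N}\}\le B_i$; (A5) $D:=\max_{i=1,\dots,d}\sup\{(x_i-y_i)^2:(x_j)_j,(y_j)_j\in X\}<+\infty$; (C1) $\boldsymbol{\xi}_0,\boldsymbol{\xi}_1,\dots$ is an independent and identically distributed sample of realizations of $\boldsymbol{\xi}$; (C2) there is an oracle which, for a given $(\mathbf{x},\boldsymbol{\xi})\in\mathbb{R}^d\times\Xi$, returns a stochastic gradient $\mathsf{G}(\mathbf{x},\boldsymbol{\xi})$ with $\mathbb{E}[\mathsf{G}(\mathbf{x},\boldsymbol{\xi})]=\nabla f(\mathbf{x})$; (C3) there is a positive number $M$ such that $\mathbb{E}[\|\mathsf{G}(\mathbf{x},\boldsymbol{\xi})\|^2]\le M^2$ for all $\mathbf{x}\in X$. Let $(\mathbf{x}_n)_{n\in\mathbb{N}}$ be the sequence generated by the algorithm described in the context with $\alpha_n$ and $\beta_n$ ($n\in\mathbb{N}$). (i) If $\sum_{n=0}^{+\infty}\alpha_n=+\infty$,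 $\sum_{n=0}^{+\infty}\alpha_n^2<+\infty$ and $\sum_{n=0}^{+\infty}\alpha_n\beta_n<+\infty$, then, for all $\mathbf{x}\in X$, $$\limsup_{n\to+\infty}\mathbb{E}\left[\langle\mathbf{x}-\mathbf{x}_n,\nabla f(\mathbf{x}_n)\rangle\right]\ge 0.$$ (ii) Moreover, if $\alpha_n:=1/n^\eta$ with $\eta\in[1/2,1)$ and $\beta_n:=\lambda^n$ with $\lambda\in(0,1)$ (for $n\ge1$), then, for all $\mathbf{x}\in X$, the algorithm achieves the convergence rate $$\frac1n\sum_{k=1}^n\mathbb{E}\left[\langle\mathbf{x}-\mathbf{x}_k,\nabla f(\mathbf{x}_k)\rangle\right]\ge-\mathcal{O}\left(\frac{1}{n^{1-\eta}}\right).$$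
   Context: $\mathbb{N}=\{0,1,2,\dots\}$; $\langle\cdot,\cdot\rangle$ and $\|\cdot\|$ are the Euclidean inner product and norm on $\mathbb{R}^d$. For a symmetric positive-definite matrix $H$, $\|\mathbf{x}\|_H^2:=\langle\mathbf{x},H\mathbf{x}\rangle$, and $P_{X,H}$ is the metric projection onto $X$ under the norm $\|\cdot\|_H$. $\boldsymbol{\xi}$ is a random vector whose distribution is supported on a set $\Xi\subset\mathbb{R}^{d_1}$, and $\nabla f$ is the gradient of $f$. Algorithm. Parameters: $(\alpha_n)_{n\in\mathbb{N}}\subset(0,1)$ (in (ii), $\alpha_1=1$ is allowed), $(\beta_n)_{n\in\mathbb{N}}\subset[0,1)$, $\gamma\in[0,1)$. Initialize with $\mathbf{x}_0,\mathbf{m}_{-1}\in\mathbb{R}^d$ and a symmetric positive-definite diagonal $d\times d$ matrix $\mathsf{H}_0$. For $n=0,1,2,\dots$: set $$\mathbf{m}_n:=\beta_n\mathbf{m}_{n-1}+(1-\beta_n)\mathsf{G}(\mathbf{x}_n,\boldsymbol{\xi}_n),\qquad \hat{\mathbf{m}}_n:=\frac{\mathbf{m}_n}{1-\gamma^{n+1}};$$ take a (possibly random) symmetric positive-definite diagonal matrix $\mathsf{H}_n=\mathrm{diag}(h_{n,1},\dots,h_{n,d})$, $h_{n,i}>0$; find $\mathbf{d}_n\in\mathbb{R}^d$ solving $\mathsf{H}_n\mathbf{d}=-\hat{\mathbf{m}}_n$; set $\mathbf{x}_{n+1}:=P_{X,\mathsf{H}_n}(\mathbf{x}_n+\alpha_n\mathbf{d}_n)$.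 The iterate $\mathbf{x}_n$ is a function of $(\boldsymbol{\xi}_0,\dots,\boldsymbol{\xi}_{n-1})$. *)

theory Defs
  imports "HOL-Probability.Probability" "HOL-Library.Landau_Symbols"
begin

definition grad :: "('a::real_inner \<Rightarrow> real) \<Rightarrow> 'a \<Rightarrow> 'a" where
  "grad f x = (THE D. GDERIV f x :> D)"

lemma GDERIV_imp_grad_eq: "GDERIV f x :> D \<Longrightarrow> grad f x = D"
  unfolding grad_def gderiv_def
proof (rule the_equality)
  fix D' assume "FDERIV f x :> (\<lambda>h. inner h D)" "FDERIV f x :> (\<lambda>h. inner h D')"
  then have "(\<lambda>h. inner h D) = (\<lambda>h. inner h D')" by (rule has_derivative_unique)
  then have "inner (D' - D) (D' - D) = 0"
    by (metis inner_diff_right right_minus_eq)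
  then show "D' = D" by simp
qed

definition diag_matrix :: "real^'d \<Rightarrow> real^'d^'d" where
  "diag_matrix h = (\<chi> i j. if i = j then h $ i else 0)"

definition norm_wrt :: "real^'d^'d \<Rightarrow> real^'d \<Rightarrow> real" where
  "norm_wrt H x = sqrt (x \<bullet> (H *v x))"

text \<open>The minimiser below exists and is unique when \<open>X\<close> is nonempty, closed and convex and
  \<open>H\<close> is symmetric positive definite, the only case in which the projection is used.\<close>

definition metric_proj :: "(real^'d) set \<Rightarrow> real^'d^'d \<Rightarrow> real^'d \<Rightarrow> real^'d" where
  "metric_proj X H x =
     (THE p. p \<in> X \<and> (\<forall>y\<in>X. norm_wrt H (x - p) \<le> norm_wrt H (x - y)))"

text \<open>A single sample path of the algorithm: \<open>\<xi> n\<close> is the \<open>n\<close>-th sample, \<open>h n\<close> the diagonal of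
  \<open>H\<^sub>n\<close>, and \<open>h0\<close>, \<open>x0\<close>, \<open>m_init\<close> the initial data, where \<open>m_init\<close> is the momentum vector of
  index \<open>-1\<close>.\<close>

definition algorithm_path ::
  "(real^'d) set \<Rightarrow> (real^'d \<Rightarrow> real^'e \<Rightarrow> real^'d) \<Rightarrow> (nat \<Rightarrow> real) \<Rightarrow> (nat \<Rightarrow> real) \<Rightarrow> real \<Rightarrow>
   real^'d \<Rightarrow> real^'d \<Rightarrow> real^'d \<Rightarrow> (nat \<Rightarrow> real^'e) \<Rightarrow> (nat \<Rightarrow> real^'d) \<Rightarrow> (nat \<Rightarrow> real^'d) \<Rightarrow> bool"
where
  "algorithm_path X G \<alpha> \<beta> \<gamma> x0 m_init h0 \<xi> h x \<longleftrightarrow>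
     x 0 = x0 \<and> h 0 = h0 \<and> (\<forall>n i. h n $ i > 0) \<and>
     (\<exists>m mhat d. \<forall>n.
        m n = \<beta> n *\<^sub>R (if n = 0 then m_init else m (n - 1)) + (1 - \<beta> n) *\<^sub>R G (x n) (\<xi> n) \<and>
        mhat n = (1 / (1 - \<gamma> ^ (n + 1))) *\<^sub>R m n \<and>
        diag_matrix (h n) *v d n = - mhat n \<and>
        x (n + 1) = metric_proj X (diag_matrix (h n)) (x n + \<alpha> n *\<^sub>R d n))"

end

theory Submission
  imports Defs
begin

text \<open>
  Fix \<open>y\<close> in \<open>X\<close> and follow the squared distance of the iterates to \<open>y\<close>, measured in the current
  metric. The projection does not increase it, so a step adds to it at most a positive multiple of
  \<open>\<alpha> n * (1 - \<beta> n)\<close> times the inner product of \<open>y - x n\<close> with the fresh stochastic gradient, plus a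
  momentum error of order \<open>\<alpha> n * \<beta> n\<close> and a noise error of order \<open>(\<alpha> n)\<^sup>2\<close>. The iterate is independent
  of the fresh sample, so in expectation the stochastic gradient becomes the true gradient
  (\<open>mean_grad_correlation\<close>, \<open>expected_descent\<close>). The metric changes from step to step, but it
  increases, has bounded expected trace, and \<open>X\<close> is bounded in each coordinate; hence the distances
  telescope up to a bounded error, even when multiplied with increasing weights
  (\<open>weighted_telescope\<close>).

  Summing with weights 1 bounds from above the partial sums of \<open>\<alpha> n * (1 - \<beta> n) / bias_corr n\<close> times
  the expected inner product of \<open>x n - y\<close> with the gradient, which together with the divergence of the
  step sizes gives the first claim (\<open>limsup_correlation_nonneg\<close>). Summing with weights of order
  \<open>n powr \<eta>\<close> gives the rate
  (\<open>average_correlation_rate\<close>).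

  One point needs care. The starting point may lie outside \<open>X\<close>, where the stochastic gradient is
  integrable but its second moment may be infinite; this first gradient lives on in every later
  momentum vector, so the square of the momentum may have infinite expectation for all time. The
  one-step inequality \<open>projected_step_descent\<close> is therefore arranged so that the stale momentum
  enters linearly, through its norm times the diameter of \<open>X\<close>, and only the fresh gradient is squared.
\<close>

section \<open>Projection and descent in a diagonal metric\<close>

text \<open>The isometry from \<open>\<parallel>\<cdot>\<parallel>\<^bsub>H\<^esub>\<close> to the Euclidean norm, for \<open>H = diag h\<close>.\<close>

definition coord_scale :: "real^'d \<Rightarrow> real^'d \<Rightarrow> real^'d" where
  "coord_scale h v = (\<chi> i. sqrt (h $ i) * v $ i)"

lemma diag_matrix_mult: "(diag_matrix h *v v) $ i = h $ i * v $ i"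
  by (simp add: diag_matrix_def matrix_vector_mult_def if_distrib[of "\<lambda>a. a * _"] cong: if_cong)

lemma norm_wrt_diag_matrix:
  assumes "\<And>i. h $ i > 0"
  shows "norm_wrt (diag_matrix h) v = norm (coord_scale h v)"
proof -
  have "v \<bullet> (diag_matrix h *v v) = coord_scale h v \<bullet> coord_scale h v"
    unfolding inner_vec_def
  proof (intro sum.cong refl)
    fix i
    have "coord_scale h v $ i \<bullet> coord_scale h v $ i
        = (sqrt (h $ i) * sqrt (h $ i)) * (v $ i * v $ i)"
      by (simp add: coord_scale_def)
    then show "v $ i \<bullet> (diag_matrix h *v v) $ i = coord_scale h v $ i \<bullet> coord_scale h v $ i"
      using assms[of i] by (simp add: diag_matrix_mult)
  qed
  then show ?thesis by (simp add: norm_wrt_def norm_eq_sqrt_inner)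
qed

lemma linear_coord_scale: "linear (coord_scale h)"
  by (rule linearI) (simp_all add: coord_scale_def vec_eq_iff algebra_simps)

lemma inj_coord_scale:
  assumes "\<And>i. h $ i > 0"
  shows "inj (coord_scale h)"
  using assms by (auto simp: inj_def coord_scale_def vec_eq_iff less_le)

text \<open>Through the isometry, the metric projection becomes the Euclidean closest point of the scaled
  set, which is again closed and convex; membership, uniqueness and the obtuse-angle
  characterisation are pulled back from there.\<close>

lemma metric_proj_diag_variational:
  fixes X :: "(real^'d) set" and a :: "real^'d"
  assumes X: "X \<noteq> {}" "closed X" "convex X" and h: "\<And>i. h $ i > 0"
  defines "p \<equiv> metric_proj X (diag_matrix h) a"
  shows "p \<in> X"
    and "y \<in> X \<Longrightarrow> (\<Sum>i\<in>UNIV. h $ i * (a - p) $ i * (y - p) $ i) \<le> 0"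
proof -
  let ?T = "coord_scale h"
  have ne: "?T ` X \<noteq> {}" using X by simp
  have cl: "closed (?T ` X)"
    using closed_injective_linear_image[OF X(2) linear_coord_scale inj_coord_scale[of h]] h by simp
  have cv: "convex (?T ` X)"
    by (rule convex_linear_image[OF linear_coord_scale X(3)])
  obtain q where q: "q \<in> X" "closest_point (?T ` X) (?T a) = ?T q"
    using closest_point_in_set[OF cl ne] by blast
  have nrm: "norm_wrt (diag_matrix h) (u - v) = dist (?T u) (?T v)" for u v
    using norm_wrt_diag_matrix[of h "u - v"] h
    by (simp add: dist_norm linear_diff[OF linear_coord_scale])
  have "p = q"
    unfolding p_def metric_proj_def nrm
  proof (rule the_equality)
    show "q \<in> X \<and> (\<forall>y\<in>X. dist (?T a) (?T q) \<le> dist (?T a) (?T y))"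
      using q closest_point_le[OF cl, of _ "?T a"] by auto
  next
    fix r assume r: "r \<in> X \<and> (\<forall>y\<in>X. dist (?T a) (?T r) \<le> dist (?T a) (?T y))"
    then have "?T r = ?T q"
      using closest_point_unique[OF cv cl, of "?T r" "?T a"] q by auto
    then show "r = q" using inj_coord_scale[of h] h by (simp add: inj_eq)
  qed
  then show "p \<in> X" using q by simp
  show "(\<Sum>i\<in>UNIV. h $ i * (a - p) $ i * (y - p) $ i) \<le> 0" if y: "y \<in> X"
  proof -
    have "?T (a - p) \<bullet> ?T (y - p) \<le> 0"
      using closest_point_dot[OF cv cl, of "?T y" "?T a"] y q \<open>p = q\<close>
      by (simp add: linear_diff[OF linear_coord_scale])
    moreover have "?T (a - p) \<bullet> ?T (y - p) = (\<Sum>i\<in>UNIV. h $ i * (a - p) $ i * (y - p) $ i)"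
      unfolding inner_vec_def
    proof (intro sum.cong refl)
      fix i
      have "?T (a - p) $ i \<bullet> ?T (y - p) $ i
          = (sqrt (h $ i) * sqrt (h $ i)) * ((a - p) $ i * (y - p) $ i)"
        by (simp add: coord_scale_def algebra_simps)
      also have "\<dots> = h $ i * (a - p) $ i * (y - p) $ i"
        using h[of i] by simp
      finally show "?T (a - p) $ i \<bullet> ?T (y - p) $ i = h $ i * (a - p) $ i * (y - p) $ i" .
    qed
    ultimately show ?thesis by simp
  qed
qed

definition weighted_sq :: "real^'d \<Rightarrow> real^'d \<Rightarrow> real" where
  "weighted_sq h v = (\<Sum>i\<in>UNIV. h $ i * (v $ i)\<^sup>2)"

text \<open>The preconditioned direction is split into a part \<open>g\<close> (the fresh gradient) and a part \<open>e\<close> (the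
  old momentum). The variational inequality leaves a spare term \<open>-\<parallel>x - p\<parallel>\<^sup>2\<close> in the metric of \<open>h\<close>.
  Spending it on \<open>g\<close> alone moves \<open>y - p\<close> back to \<open>y - x\<close> in the \<open>g\<close> term, at the price of \<open>g\<close>
  squared; the \<open>e\<close> term keeps \<open>y - p\<close> and stays linear in \<open>e\<close>. The first is what independence
  requires, since the old iterate is independent of the fresh sample, and the second means that
  only a first moment of the momentum enters.\<close>

lemma projected_step_descent:
  fixes X :: "(real^'d) set" and x d :: "real^'d" and a :: real
  assumes X: "X \<noteq> {}" "closed X" "convex X" and h: "\<And>i. h $ i > 0"
    and d: "diag_matrix h *v d = - (g + e)"
    and y: "y \<in> X"
  defines "p \<equiv> metric_proj X (diag_matrix h) (x + a *\<^sub>R d)"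
  shows "weighted_sq h (p - y) \<le> weighted_sq h (x - y)
    + 2 * a * (g \<bullet> (y - x)) + 2 * a * (e \<bullet> (y - p)) + a\<^sup>2 * (\<Sum>i\<in>UNIV. (g $ i)\<^sup>2 / h $ i)"
proof -
  have hd: "h $ i * d $ i = - (g $ i + e $ i)" for i
    using arg_cong[OF d, of "\<lambda>v. v $ i"] by (simp add: diag_matrix_mult)
  have var: "(\<Sum>i\<in>UNIV. h $ i * (x + a *\<^sub>R d - p) $ i * (y - p) $ i) \<le> 0"
    unfolding p_def by (rule metric_proj_diag_variational(2)[OF X h y])
  have coord: "h $ i * ((p - y) $ i)\<^sup>2 \<le> h $ i * ((x - y) $ i)\<^sup>2 + 2 * a * (g $ i * (y - x) $ i)
      + 2 * a * (e $ i * (y - p) $ i) + a\<^sup>2 * ((g $ i)\<^sup>2 / h $ i)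
      + 2 * (h $ i * (x + a *\<^sub>R d - p) $ i * (y - p) $ i)" for i
  proof -
    have pos: "h $ i > 0" by (rule h)
    \<comment> \<open>The displacement term completes a square with the fresh gradient.\<close>
    have "0 \<le> h $ i * ((x - p) $ i - a * g $ i / h $ i)\<^sup>2"
      using pos by simp
    also have "\<dots> = h $ i * ((x - p) $ i)\<^sup>2 - 2 * a * g $ i * (x - p) $ i + a\<^sup>2 * ((g $ i)\<^sup>2 / h $ i)"
      using pos by (simp add: power2_diff power_divide power_mult_distrib field_simps power2_eq_square)
    finally have sq: "2 * a * g $ i * (x - p) $ i
        \<le> h $ i * ((x - p) $ i)\<^sup>2 + a\<^sup>2 * ((g $ i)\<^sup>2 / h $ i)" by simp
    have "h $ i * (x + a *\<^sub>R d - p) $ i * (y - p) $ i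
        = h $ i * (x - p) $ i * (y - p) $ i + a * (h $ i * d $ i) * (y - p) $ i"
      by (simp add: algebra_simps)
    also have "\<dots> = h $ i * (x - p) $ i * (y - p) $ i - a * (g $ i + e $ i) * (y - p) $ i"
      unfolding hd by (simp add: algebra_simps)
    finally show ?thesis using sq by (simp add: algebra_simps power2_eq_square)
  qed
  have "weighted_sq h (p - y) \<le> (\<Sum>i\<in>UNIV. h $ i * ((x - y) $ i)\<^sup>2 + 2 * a * (g $ i * (y - x) $ i)
      + 2 * a * (e $ i * (y - p) $ i) + a\<^sup>2 * ((g $ i)\<^sup>2 / h $ i)
      + 2 * (h $ i * (x + a *\<^sub>R d - p) $ i * (y - p) $ i))"
    unfolding weighted_sq_def by (intro sum_mono coord)
  also have "\<dots> = weighted_sq h (x - y)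
    + 2 * a * (g \<bullet> (y - x)) + 2 * a * (e \<bullet> (y - p)) + a\<^sup>2 * (\<Sum>i\<in>UNIV. (g $ i)\<^sup>2 / h $ i)
    + 2 * (\<Sum>i\<in>UNIV. h $ i * (x + a *\<^sub>R d - p) $ i * (y - p) $ i)"
    by (simp add: weighted_sq_def inner_vec_def sum.distrib sum_distrib_left)
  finally show ?thesis using var by simp
qed

section \<open>Real sequences\<close>

text \<open>Summation by parts. Here \<open>U k\<close> and \<open>V k\<close> are squared distances before and after step \<open>k\<close> in the
  metric of that step, and \<open>b k\<close> is the trace of the metric. Both the change of metric and the
  growth of the weights cost at most the squared diameter \<open>D\<close> times the increase of \<open>a k * b k\<close>, so
  the total cost telescopes as well.\<close>

lemma weighted_telescope:
  fixes U V b a :: "nat \<Rightarrow> real"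
  assumes start: "U 1 \<le> D * b 1"
    and step: "\<And>k. 1 \<le> k \<Longrightarrow> U (Suc k) \<le> V k + D * (b (Suc k) - b k)"
    and V: "\<And>k. 1 \<le> k \<Longrightarrow> 0 \<le> V k" "\<And>k. 1 \<le> k \<Longrightarrow> V k \<le> D * b k"
    and a: "\<And>k. 1 \<le> k \<Longrightarrow> 0 \<le> a k" "\<And>k. 1 \<le> k \<Longrightarrow> a k \<le> a (Suc k)"
    and n: "1 \<le> n"
  shows "(\<Sum>k=1..n. a k * (U k - V k)) \<le> D * a n * b n"
proof -
  \<comment> \<open>The last term \<open>a n * V n\<close> has to be kept for the induction to close.\<close>
  have "(\<Sum>k=1..n. a k * (U k - V k)) + a n * V n \<le> D * a n * b n"
    using n
  proof (induction n rule: dec_induct)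
    case base
    show ?case using mult_left_mono[OF start a(1)[of 1]] by (simp add: algebra_simps)
  next
    case (step n)
    have "a (Suc n) * U (Suc n) \<le> a (Suc n) * (V n + D * (b (Suc n) - b n))"
      using step assms(2)[of n] a(1)[of "Suc n"] by (intro mult_left_mono) auto
    moreover have "(a (Suc n) - a n) * V n \<le> (a (Suc n) - a n) * (D * b n)"
      using step V(2)[of n] a(2)[of n] by (intro mult_left_mono) auto
    ultimately show ?case using step.IH by (simp add: algebra_simps)
  qed
  moreover have "0 \<le> a n * V n" using n a V by simp
  ultimately show ?thesis by linarith
qed

text \<open>Raising the exponent above \<open>1/2\<close> decreases the left-hand side and increases the right-hand side, so
  the case of square roots decides.\<close>

lemma sum_inverse_powr_le:
  assumes \<eta>: "1 / 2 \<le> \<eta>"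
  shows "(\<Sum>k=1..n. 1 / real k powr \<eta>) \<le> 2 * real n powr \<eta>"
proof (cases "n = 0")
  case False
  have "(\<Sum>k=1..n. 1 / real k powr \<eta>) \<le> (\<Sum>k=1..n. 1 / sqrt (real k))"
  proof (rule sum_mono)
    fix k assume "k \<in> {1..n}"
    then have "sqrt (real k) \<le> real k powr \<eta>"
      using powr_mono[OF \<eta>, of "real k"] by (simp add: powr_half_sqrt)
    then show "1 / real k powr \<eta> \<le> 1 / sqrt (real k)"
      using \<open>k \<in> {1..n}\<close> by (intro divide_left_mono) auto
  qed
  also have "\<dots> \<le> 2 * sqrt (real n)"
  proof (induction n)
    case (Suc n)
    \<comment> \<open>\<open>1 / b \<le> 2 * (b - a)\<close> amounts to \<open>(b - a)\<^sup>2 \<ge> 0\<close> because \<open>b\<^sup>2 = a\<^sup>2 + 1\<close>.\<close>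
    let ?a = "sqrt (real n)" and ?b = "sqrt (real (Suc n))"
    have b: "0 < ?b" and sq: "?b * ?b = ?a * ?a + 1" by simp_all
    have "0 \<le> (?b - ?a) * (?b - ?a)" by simp
    then have "2 * ?a * ?b + 1 \<le> 2 * ?b * ?b" using sq by (simp add: algebra_simps)
    then have "2 * ?a + 1 / ?b \<le> 2 * ?b" using b by (simp add: field_simps)
    then show ?case using Suc by simp
  qed simp
  also have "\<dots> \<le> 2 * real n powr \<eta>"
    using powr_mono[OF \<eta>, of "real n"] False by (simp add: powr_half_sqrt)
  finally show ?thesis .
qed simp

section \<open>Independence of the past and the fresh sample\<close>

text \<open>Past and fresh samples are independent as families of coordinates. The iterate, a function of the
  past, and the fresh sample itself are images of these families, and images of a product measure
  under a product map are again product measures.\<close>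

lemma (in prob_space) joint_law_past_sample:
  fixes \<xi> :: "nat \<Rightarrow> 'a \<Rightarrow> 'b::{second_countable_topology, topological_space}"
    and u :: "'a \<Rightarrow> 'c::{second_countable_topology, topological_space}"
  assumes indep: "indep_vars (\<lambda>_. borel) \<xi> UNIV"
    and \<phi>: "\<phi> \<in> borel_measurable (\<Pi>\<^sub>M k\<in>{..<n}. borel)"
    and u: "\<And>\<omega>. \<omega> \<in> space M \<Longrightarrow> u \<omega> = \<phi> (\<lambda>k\<in>{..<n}. \<xi> k \<omega>)"
  shows "u \<in> borel_measurable M"
    and "distr M (borel \<Otimes>\<^sub>M borel) (\<lambda>\<omega>. (u \<omega>, \<xi> n \<omega>)) = distr M borel u \<Otimes>\<^sub>M distr M borel (\<xi> n)"
proof -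
  let ?past = "\<lambda>\<omega>. \<lambda>k\<in>{..<n}. \<xi> k \<omega>"
  let ?fresh = "\<lambda>\<omega>. \<lambda>k\<in>{n}. \<xi> k \<omega>"
  let ?A = "\<Pi>\<^sub>M k\<in>{..<n}. (borel :: 'b measure)" and ?N = "\<Pi>\<^sub>M k\<in>{n}. (borel :: 'b measure)"
  have "indep_var ?A ?past ?N ?fresh"
    by (rule indep_var_restrict[OF indep]) auto
  then have past: "?past \<in> measurable M ?A" and fresh: "?fresh \<in> measurable M ?N"
    and split: "distr M ?A ?past \<Otimes>\<^sub>M distr M ?N ?fresh = distr M (?A \<Otimes>\<^sub>M ?N) (\<lambda>\<omega>. (?past \<omega>, ?fresh \<omega>))"
    unfolding indep_var_distribution_eq by auto
  have comp: "(\<lambda>p. p n) \<in> borel_measurable ?N"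
    by simp
  have meas: "\<phi> \<circ> ?past \<in> borel_measurable M"
    using past \<phi> by (rule measurable_comp)
  have law_past: "distr M borel (\<phi> \<circ> ?past) = distr (distr M ?A ?past) borel \<phi>"
    by (rule distr_distr[OF \<phi> past, symmetric])
  have law_fresh: "distr M borel (\<xi> n) = distr (distr M ?N ?fresh) borel (\<lambda>p. p n)"
    by (subst distr_distr[OF comp fresh]) (simp add: o_def)
  have \<xi>: "\<xi> n \<in> borel_measurable M"
    using indep by (simp add: indep_vars_def)
  interpret F: prob_space "distr M borel (\<xi> n)"
    using \<xi> by (rule prob_space_distr)
  have "distr M borel (\<phi> \<circ> ?past) \<Otimes>\<^sub>M distr M borel (\<xi> n)
      = distr (distr M ?A ?past \<Otimes>\<^sub>M distr M ?N ?fresh) (borel \<Otimes>\<^sub>M borel) (\<lambda>(a, b). (\<phi> a, b n))"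
    unfolding law_past law_fresh
  proof (rule pair_measure_distr)
    show "sigma_finite_measure (distr (distr M ?N ?fresh) borel (\<lambda>p. p n))"
      unfolding law_fresh[symmetric] ..
  qed (use \<phi> comp in simp_all)
  also have "\<dots> = distr M (borel \<Otimes>\<^sub>M borel) (\<lambda>\<omega>. ((\<phi> \<circ> ?past) \<omega>, \<xi> n \<omega>))"
    unfolding split using \<phi> comp past fresh
    by (subst distr_distr) (auto simp: o_def)
  finally have law: "distr M borel (\<phi> \<circ> ?past) \<Otimes>\<^sub>M distr M borel (\<xi> n)
      = distr M (borel \<Otimes>\<^sub>M borel) (\<lambda>\<omega>. ((\<phi> \<circ> ?past) \<omega>, \<xi> n \<omega>))" .
  show "u \<in> borel_measurable M"
    using meas by (rule measurable_cong[THEN iffD1, rotated]) (simp add: u)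
  have "distr M borel u = distr M borel (\<phi> \<circ> ?past)"
    by (rule distr_cong) (simp_all add: u)
  moreover have "distr M (borel \<Otimes>\<^sub>M borel) (\<lambda>\<omega>. (u \<omega>, \<xi> n \<omega>))
      = distr M (borel \<Otimes>\<^sub>M borel) (\<lambda>\<omega>. ((\<phi> \<circ> ?past) \<omega>, \<xi> n \<omega>))"
    by (rule distr_cong) (simp_all add: u)
  ultimately show "distr M (borel \<Otimes>\<^sub>M borel) (\<lambda>\<omega>. (u \<omega>, \<xi> n \<omega>))
      = distr M borel u \<Otimes>\<^sub>M distr M borel (\<xi> n)"
    using law by simp
qed

section \<open>Moments along the algorithm\<close>

text \<open>Turns second moments into first moments with a constant that depends on the second moment only.\<close>

lemma norm_le_one_plus_square: "norm v \<le> 1 + (norm v)\<^sup>2"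
proof -
  have "0 \<le> (norm v - 1 / 2)\<^sup>2" by simp
  then have "norm v \<le> (norm v)\<^sup>2 + 1 / 4"
    by (simp add: power2_eq_square algebra_simps)
  then show ?thesis by simp
qed

lemma borel_measurable_component [measurable]:
  fixes u :: "'a \<Rightarrow> real^'n"
  assumes "u \<in> borel_measurable N"
  shows "(\<lambda>\<omega>. u \<omega> $ i) \<in> borel_measurable N"
  using assms borel_measurable_nth by (rule measurable_compose)

text \<open>The algorithm with the momentum and direction processes made explicit, and with independence
  reduced to the joint law of the current iterate and the fresh sample. The starting point \<open>x0\<close> may
  lie outside \<open>X\<close>; the first gradient then has a first moment but possibly no second moment, and for
  this reason the descent estimates below begin at index 1.\<close>

locale adaptive_method = prob_space M
  for M :: "'w measure" +
  fixes X :: "(real^'d) set" and P :: "(real^'e) measure"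
    and G :: "real^'d \<Rightarrow> real^'e \<Rightarrow> real^'d"
    and \<xi> :: "nat \<Rightarrow> 'w \<Rightarrow> real^'e"
    and h x m d :: "nat \<Rightarrow> 'w \<Rightarrow> real^'d"
    and x0 m_init h0 :: "real^'d"
    and \<alpha> \<beta> :: "nat \<Rightarrow> real" and \<gamma> D K B :: real
  assumes P: "prob_space P"
    and X: "X \<noteq> {}" "closed X" "convex X"
    and coord_diam: "\<And>y z i. y \<in> X \<Longrightarrow> z \<in> X \<Longrightarrow> (y $ i - z $ i)\<^sup>2 \<le> D"
    and G_measurable: "(\<lambda>(y, s). G y s) \<in> borel_measurable (borel \<Otimes>\<^sub>M borel)"
    and G_integrable: "\<And>y. integrable P (G y)"
    and G_second_moment: "\<And>y. y \<in> X \<Longrightarrow> (\<integral>\<^sup>+s. ennreal ((norm (G y s))\<^sup>2) \<partial>P) \<le> ennreal (K\<^sup>2)"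
    and \<xi>_measurable: "\<And>n. \<xi> n \<in> borel_measurable M"
    and \<xi>_law: "\<And>n. distr M borel (\<xi> n) = P"
    and x_measurable: "\<And>n. x n \<in> borel_measurable M"
    and joint_law: "\<And>n. distr M (borel \<Otimes>\<^sub>M borel) (\<lambda>\<omega>. (x n \<omega>, \<xi> n \<omega>)) = distr M borel (x n) \<Otimes>\<^sub>M P"
    and beta: "\<And>n. 0 \<le> \<beta> n" "\<And>n. \<beta> n < 1"
    and gamma: "0 \<le> \<gamma>" "\<gamma> < 1"
    and h_pos: "\<And>n i \<omega>. \<omega> \<in> space M \<Longrightarrow> h n \<omega> $ i > 0"
    and h_0: "\<And>\<omega>. \<omega> \<in> space M \<Longrightarrow> h 0 \<omega> = h0"
    and x_0: "\<And>\<omega>. \<omega> \<in> space M \<Longrightarrow> x 0 \<omega> = x0"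
    and m_0: "\<And>\<omega>. \<omega> \<in> space M \<Longrightarrow> m 0 \<omega> = \<beta> 0 *\<^sub>R m_init + (1 - \<beta> 0) *\<^sub>R G (x 0 \<omega>) (\<xi> 0 \<omega>)"
    and m_Suc: "\<And>n \<omega>. \<omega> \<in> space M \<Longrightarrow>
      m (Suc n) \<omega> = \<beta> (Suc n) *\<^sub>R m n \<omega> + (1 - \<beta> (Suc n)) *\<^sub>R G (x (Suc n) \<omega>) (\<xi> (Suc n) \<omega>)"
    and direction: "\<And>n \<omega>. \<omega> \<in> space M \<Longrightarrow>
      diag_matrix (h n \<omega>) *v d n \<omega> = - ((1 / (1 - \<gamma> ^ (n + 1))) *\<^sub>R m n \<omega>)"
    and x_Suc: "\<And>n \<omega>. \<omega> \<in> space M \<Longrightarrow>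
      x (Suc n) \<omega> = metric_proj X (diag_matrix (h n \<omega>)) (x n \<omega> + \<alpha> n *\<^sub>R d n \<omega>)"
    and h_measurable: "\<And>n. h n \<in> borel_measurable M"
    and h_mono: "\<And>n i. AE \<omega> in M. h n \<omega> $ i \<le> h (Suc n) \<omega> $ i"
    and h_mean: "\<And>n. (\<integral>\<^sup>+\<omega>. ennreal (\<Sum>i\<in>UNIV. h n \<omega> $ i) \<partial>M) \<le> ennreal B"
    and B_nonneg: "0 \<le> B"
begin

definition mean_grad :: "real^'d \<Rightarrow> real^'d" where
  "mean_grad y = (\<integral>s. G y s \<partial>P)"

abbreviation sample :: "nat \<Rightarrow> 'w \<Rightarrow> real^'d" where
  "sample n \<omega> \<equiv> G (x n \<omega>) (\<xi> n \<omega>)"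

definition trace_mean :: "nat \<Rightarrow> real" where
  "trace_mean n = (\<integral>\<omega>. (\<Sum>i\<in>UNIV. h n \<omega> $ i) \<partial>M)"

text \<open>A bound for the Euclidean diameter of \<open>X\<close>, summed over the coordinates.\<close>

definition diam :: real where
  "diam = (\<Sum>i\<in>(UNIV::'d set). sqrt D)"

definition bias_corr :: "nat \<Rightarrow> real" where
  "bias_corr n = 1 - \<gamma> ^ (n + 1)"

lemma sets_P: "sets P = sets borel"
  using \<xi>_law[of 0] by (metis sets_distr)

lemma bias_corr_bounds: "1 - \<gamma> \<le> bias_corr n" "0 < bias_corr n" "bias_corr n \<le> 1" "bias_corr n \<le> bias_corr (Suc n)"
proof -
  have "\<gamma> ^ (n + 1) \<le> \<gamma>"
    using gamma power_decreasing[of 1 "n + 1" \<gamma>] by simp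
  then show "1 - \<gamma> \<le> bias_corr n" by (simp add: bias_corr_def)
  then show "0 < bias_corr n" using gamma by simp
  show "bias_corr n \<le> 1" using gamma by (simp add: bias_corr_def)
  show "bias_corr n \<le> bias_corr (Suc n)"
    using gamma power_decreasing[of "n + 1" "Suc n + 1" \<gamma>] by (simp add: bias_corr_def)
qed

lemma D_nonneg: "0 \<le> D"
proof -
  obtain y where "y \<in> X" using X by blast
  then show ?thesis using coord_diam[of y y] by simp
qed

lemma norm_diff_le_diam:
  assumes "y \<in> X" "z \<in> X"
  shows "norm (y - z) \<le> diam"
proof -
  have "norm (y - z) \<le> (\<Sum>i\<in>UNIV. \<bar>(y - z) $ i\<bar>)"
    by (rule norm_le_l1_cart)
  also have "\<dots> \<le> diam"
    unfolding diam_def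
    using coord_diam[OF assms] by (intro sum_mono) (simp add: real_le_rsqrt)
  finally show ?thesis .
qed

lemma diam_nonneg: "0 \<le> diam"
  by (simp add: diam_def D_nonneg sum_nonneg)

lemma x_in_X: "1 \<le> n \<Longrightarrow> \<omega> \<in> space M \<Longrightarrow> x n \<omega> \<in> X"
  using metric_proj_diag_variational(1)[OF X] x_Suc[of \<omega> "n - 1"] h_pos[of \<omega> "n - 1"] by simp

lemma sample_measurable: "sample n \<in> borel_measurable M"
proof -
  have "(\<lambda>\<omega>. (x n \<omega>, \<xi> n \<omega>)) \<in> measurable M (borel \<Otimes>\<^sub>M borel)"
    using x_measurable \<xi>_measurable by simp
  from measurable_compose[OF this G_measurable] show ?thesis by simp
qed

lemma mean_grad_measurable: "mean_grad \<in> borel_measurable borel"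
proof -
  interpret P: prob_space P by (rule P)
  have "(\<lambda>(y, s). G y s) \<in> borel_measurable (borel \<Otimes>\<^sub>M P)"
    using G_measurable by (simp add: sets_P cong: measurable_cong_sets sets_pair_measure_cong)
  from P.borel_measurable_lebesgue_integral[of G, OF this] show ?thesis
    unfolding mean_grad_def .
qed

text \<open>Conditioning on the past: the fresh sample is integrated out first, with the iterate frozen. The
  version for nonnegative functions supplies the moment bounds that make the second version, for
  integrable functions, applicable.\<close>

lemma nn_integral_sample:
  fixes q :: "(real^'d) \<times> (real^'e) \<Rightarrow> ennreal"
  assumes q: "q \<in> borel_measurable (borel \<Otimes>\<^sub>M borel)"
  shows "(\<integral>\<^sup>+\<omega>. q (x n \<omega>, \<xi> n \<omega>) \<partial>M) = (\<integral>\<^sup>+\<omega>. (\<integral>\<^sup>+s. q (x n \<omega>, s) \<partial>P) \<partial>M)"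
proof -
  interpret P: prob_space P by (rule P)
  have [measurable]: "x n \<in> borel_measurable M" "\<xi> n \<in> borel_measurable M"
    by (rule x_measurable, rule \<xi>_measurable)
  have q': "q \<in> borel_measurable (borel \<Otimes>\<^sub>M P)"
    using q by (simp add: sets_P cong: measurable_cong_sets sets_pair_measure_cong)
  have "(\<integral>\<^sup>+\<omega>. q (x n \<omega>, \<xi> n \<omega>) \<partial>M) = integral\<^sup>N (distr M borel (x n) \<Otimes>\<^sub>M P) q"
    using q by (subst joint_law[symmetric], subst nn_integral_distr) auto
  also have "\<dots> = (\<integral>\<^sup>+u. (\<integral>\<^sup>+s. q (u, s) \<partial>P) \<partial>distr M borel (x n))"
    by (rule P.nn_integral_fst[symmetric])
       (use q' in \<open>simp cong: measurable_cong_sets sets_pair_measure_cong\<close>)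
  also have "\<dots> = (\<integral>\<^sup>+\<omega>. (\<integral>\<^sup>+s. q (x n \<omega>, s) \<partial>P) \<partial>M)"
    using P.borel_measurable_nn_integral_fst[OF q'] by (subst nn_integral_distr) auto
  finally show ?thesis .
qed

lemma integral_sample:
  fixes q :: "(real^'d) \<times> (real^'e) \<Rightarrow> real"
  assumes q: "q \<in> borel_measurable (borel \<Otimes>\<^sub>M borel)"
    and int: "integrable M (\<lambda>\<omega>. q (x n \<omega>, \<xi> n \<omega>))"
  shows "(\<integral>\<omega>. q (x n \<omega>, \<xi> n \<omega>) \<partial>M) = (\<integral>\<omega>. (\<integral>s. q (x n \<omega>, s) \<partial>P) \<partial>M)"
proof -
  interpret P: prob_space P by (rule P)
  have [measurable]: "x n \<in> borel_measurable M" "\<xi> n \<in> borel_measurable M"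
    by (rule x_measurable, rule \<xi>_measurable)
  interpret N: prob_space "distr M borel (x n)"
    by (rule prob_space_distr) simp
  interpret NP: pair_sigma_finite "distr M borel (x n)" P ..
  have q': "q \<in> borel_measurable (borel \<Otimes>\<^sub>M P)"
    using q by (simp add: sets_P cong: measurable_cong_sets sets_pair_measure_cong)
  have inner_meas: "(\<lambda>u. \<integral>s. q (u, s) \<partial>P) \<in> borel_measurable borel"
    using P.borel_measurable_lebesgue_integral[of "\<lambda>u s. q (u, s)" borel] q' by simp
  have "(\<integral>\<omega>. q (x n \<omega>, \<xi> n \<omega>) \<partial>M) = integral\<^sup>L (distr M borel (x n) \<Otimes>\<^sub>M P) q"
    using q by (subst joint_law[symmetric], subst integral_distr) auto
  also have "\<dots> = (\<integral>u. (\<integral>s. q (u, s) \<partial>P) \<partial>distr M borel (x n))"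
  proof (rule NP.integral_fst'[symmetric])
    show "integrable (distr M borel (x n) \<Otimes>\<^sub>M P) q"
      using q int by (subst joint_law[symmetric], subst integrable_distr_eq) auto
  qed
  also have "\<dots> = (\<integral>\<omega>. (\<integral>s. q (x n \<omega>, s) \<partial>P) \<partial>M)"
    using inner_meas by (subst integral_distr) auto
  finally show ?thesis .
qed

lemma sample_second_moment:
  assumes n: "1 \<le> n"
  shows "integrable M (\<lambda>\<omega>. (norm (sample n \<omega>))\<^sup>2)"
    and "(\<integral>\<omega>. (norm (sample n \<omega>))\<^sup>2 \<partial>M) \<le> K\<^sup>2"
proof -
  have [measurable]: "sample n \<in> borel_measurable M" by (rule sample_measurable)
  have "(\<lambda>p. norm (case p of (y, s) \<Rightarrow> G y s)) \<in> borel_measurable (borel \<Otimes>\<^sub>M borel)"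
    using G_measurable by (rule measurable_compose[OF _ borel_measurable_norm])
  then have "(\<lambda>p. ennreal ((norm (case p of (y, s) \<Rightarrow> G y s))\<^sup>2)) \<in> borel_measurable (borel \<Otimes>\<^sub>M borel)"
    by measurable
  from nn_integral_sample[OF this, of n]
  have "(\<integral>\<^sup>+\<omega>. ennreal ((norm (sample n \<omega>))\<^sup>2) \<partial>M)
      = (\<integral>\<^sup>+\<omega>. (\<integral>\<^sup>+s. ennreal ((norm (G (x n \<omega>) s))\<^sup>2) \<partial>P) \<partial>M)"
    by simp
  also have "\<dots> \<le> (\<integral>\<^sup>+\<omega>. ennreal (K\<^sup>2) \<partial>M)"
    using x_in_X[OF n] G_second_moment by (intro nn_integral_mono) auto
  also have "\<dots> = ennreal (K\<^sup>2)"
    by (simp add: emeasure_space_1)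
  finally have bound: "(\<integral>\<^sup>+\<omega>. ennreal ((norm (sample n \<omega>))\<^sup>2) \<partial>M) \<le> ennreal (K\<^sup>2)" .
  show int: "integrable M (\<lambda>\<omega>. (norm (sample n \<omega>))\<^sup>2)"
    using bound by (intro integrableI_nonneg) (auto simp: le_less_trans[OF _ ennreal_less_top])
  show "(\<integral>\<omega>. (norm (sample n \<omega>))\<^sup>2 \<partial>M) \<le> K\<^sup>2"
    using bound nn_integral_eq_integral[OF int] by simp
qed

lemma sample_first_moment:
  assumes n: "1 \<le> n"
  shows "integrable M (sample n)"
    and "(\<integral>\<omega>. norm (sample n \<omega>) \<partial>M) \<le> 1 + K\<^sup>2"
proof -
  note sq = sample_second_moment[OF n]
  have int: "integrable M (\<lambda>\<omega>. 1 + (norm (sample n \<omega>))\<^sup>2)"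
    using sq(1) by simp
  show intS: "integrable M (sample n)"
    by (rule Bochner_Integration.integrable_bound[OF int sample_measurable])
       (auto intro: order_trans[OF norm_le_one_plus_square])
  have "(\<integral>\<omega>. norm (sample n \<omega>) \<partial>M) \<le> (\<integral>\<omega>. 1 + (norm (sample n \<omega>))\<^sup>2 \<partial>M)"
    using intS int norm_le_one_plus_square by (intro integral_mono) auto
  also have "\<dots> = 1 + (\<integral>\<omega>. (norm (sample n \<omega>))\<^sup>2 \<partial>M)"
    using sq(1) by (simp add: prob_space)
  finally show "(\<integral>\<omega>. norm (sample n \<omega>) \<partial>M) \<le> 1 + K\<^sup>2" using sq(2) by simp
qed

lemma norm_mean_grad_le:
  assumes y: "y \<in> X"
  shows "norm (mean_grad y) \<le> 1 + K\<^sup>2"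
proof -
  interpret P: prob_space P by (rule P)
  have [measurable]: "G y \<in> borel_measurable P"
    using G_integrable by (rule borel_measurable_integrable)
  have bound: "(\<integral>\<^sup>+s. ennreal ((norm (G y s))\<^sup>2) \<partial>P) \<le> ennreal (K\<^sup>2)"
    by (rule G_second_moment[OF y])
  have int: "integrable P (\<lambda>s. (norm (G y s))\<^sup>2)"
    using bound by (intro integrableI_nonneg) (auto simp: le_less_trans[OF _ ennreal_less_top])
  have "norm (mean_grad y) \<le> (\<integral>s. norm (G y s) \<partial>P)"
    unfolding mean_grad_def by (rule integral_norm_bound)
  also have "\<dots> \<le> (\<integral>s. 1 + (norm (G y s))\<^sup>2 \<partial>P)"
    using G_integrable[of y] int norm_le_one_plus_square by (intro integral_mono) auto
  also have "\<dots> = 1 + (\<integral>s. (norm (G y s))\<^sup>2 \<partial>P)"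
    using int by (simp add: P.prob_space)
  also have "\<dots> \<le> 1 + K\<^sup>2"
    using bound nn_integral_eq_integral[OF int] by simp
  finally show ?thesis .
qed

definition momentum_bound :: real where
  "momentum_bound = max (\<integral>\<omega>. norm (m 0 \<omega>) \<partial>M) (1 + K\<^sup>2)"

text \<open>The momentum is a convex combination of its predecessor and a fresh gradient. Only the first
  moment propagates in this way, since the initial gradient may have infinite second moment.\<close>

lemma momentum_first_moment:
  "integrable M (m n)" "(\<integral>\<omega>. norm (m n \<omega>) \<partial>M) \<le> momentum_bound"
proof (induction n)
  case 0
  have "integrable (distr M borel (\<xi> 0)) (G x0)"
    using G_integrable by (simp add: \<xi>_law)
  then have "integrable M (\<lambda>\<omega>. G x0 (\<xi> 0 \<omega>))"
    by (rule integrable_distr[OF \<xi>_measurable])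
  then have "integrable M (\<lambda>\<omega>. \<beta> 0 *\<^sub>R m_init + (1 - \<beta> 0) *\<^sub>R G x0 (\<xi> 0 \<omega>))"
    by simp
  then show "integrable M (m 0)"
    by (subst Bochner_Integration.integrable_cong[OF refl m_0]) (simp_all add: x_0 cong: Bochner_Integration.integrable_cong)
  show "(\<integral>\<omega>. norm (m 0 \<omega>) \<partial>M) \<le> momentum_bound"
    by (simp add: momentum_bound_def)
next
  case (Suc n)
  let ?b = "\<beta> (Suc n)"
  note S = sample_first_moment[of "Suc n", simplified]
  have b: "0 \<le> ?b" "0 \<le> 1 - ?b" using beta[of "Suc n"] by auto
  have "integrable M (\<lambda>\<omega>. ?b *\<^sub>R m n \<omega> + (1 - ?b) *\<^sub>R sample (Suc n) \<omega>)"
    using Suc.IH(1) S(1) by simp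
  then show int: "integrable M (m (Suc n))"
    by (subst Bochner_Integration.integrable_cong[OF refl m_Suc])
  have "(\<integral>\<omega>. norm (m (Suc n) \<omega>) \<partial>M)
      \<le> (\<integral>\<omega>. ?b * norm (m n \<omega>) + (1 - ?b) * norm (sample (Suc n) \<omega>) \<partial>M)"
  proof (rule integral_mono)
    fix \<omega> assume "\<omega> \<in> space M"
    then show "norm (m (Suc n) \<omega>) \<le> ?b * norm (m n \<omega>) + (1 - ?b) * norm (sample (Suc n) \<omega>)"
      using b by (simp add: m_Suc order_trans[OF norm_triangle_ineq])
  qed (use int Suc.IH(1) S(1) in auto)
  also have "\<dots> = ?b * (\<integral>\<omega>. norm (m n \<omega>) \<partial>M) + (1 - ?b) * (\<integral>\<omega>. norm (sample (Suc n) \<omega>) \<partial>M)"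
    using Suc.IH(1) S(1) by simp
  also have "\<dots> \<le> ?b * momentum_bound + (1 - ?b) * momentum_bound"
    using b Suc.IH(2) S(2)
    by (intro add_mono mult_left_mono) (auto simp: momentum_bound_def)
  finally show "(\<integral>\<omega>. norm (m (Suc n) \<omega>) \<partial>M) \<le> momentum_bound"
    by (simp add: algebra_simps)
qed


text \<open>Unbiasedness: the iterate is frozen while the fresh sample is averaged, so the stochastic gradient
  may be replaced by its mean.\<close>

lemma mean_grad_correlation:
  assumes n: "1 \<le> n" and y: "y \<in> X"
  shows "integrable M (\<lambda>\<omega>. sample n \<omega> \<bullet> (y - x n \<omega>))"
    and "(\<integral>\<omega>. sample n \<omega> \<bullet> (y - x n \<omega>) \<partial>M) = (\<integral>\<omega>. (y - x n \<omega>) \<bullet> mean_grad (x n \<omega>) \<partial>M)"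
proof -
  have [measurable]: "x n \<in> borel_measurable M" "sample n \<in> borel_measurable M"
    by (rule x_measurable, rule sample_measurable)
  have "integrable M (\<lambda>\<omega>. diam * norm (sample n \<omega>))"
    using sample_first_moment(1)[OF n] by simp
  then show int: "integrable M (\<lambda>\<omega>. sample n \<omega> \<bullet> (y - x n \<omega>))"
  proof (rule Bochner_Integration.integrable_bound)
    show "AE \<omega> in M. norm (sample n \<omega> \<bullet> (y - x n \<omega>)) \<le> norm (diam * norm (sample n \<omega>))"
    proof (rule AE_I2)
      fix \<omega> assume "\<omega> \<in> space M"
      then have "norm (y - x n \<omega>) \<le> diam"
        using norm_diff_le_diam[OF y] x_in_X[OF n] by simp
      then have "norm (sample n \<omega>) * norm (y - x n \<omega>) \<le> norm (sample n \<omega>) * diam"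
        by (rule mult_left_mono) simp
      then show "norm (sample n \<omega> \<bullet> (y - x n \<omega>)) \<le> norm (diam * norm (sample n \<omega>))"
        using Cauchy_Schwarz_ineq2[of "sample n \<omega>" "y - x n \<omega>"] diam_nonneg
        by (simp add: abs_mult mult.commute)
    qed
  qed simp
  have "(\<lambda>p. (case p of (u, s) \<Rightarrow> G u s) \<bullet> (y - fst p)) \<in> borel_measurable (borel \<Otimes>\<^sub>M borel)"
    using G_measurable by (intro borel_measurable_inner borel_measurable_diff) simp_all
  from integral_sample[OF this, of n] int
  have "(\<integral>\<omega>. sample n \<omega> \<bullet> (y - x n \<omega>) \<partial>M) = (\<integral>\<omega>. (\<integral>s. G (x n \<omega>) s \<bullet> (y - x n \<omega>) \<partial>P) \<partial>M)"
    by simp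
  also have "\<dots> = (\<integral>\<omega>. (y - x n \<omega>) \<bullet> mean_grad (x n \<omega>) \<partial>M)"
    using G_integrable by (simp add: mean_grad_def inner_commute)
  finally show "(\<integral>\<omega>. sample n \<omega> \<bullet> (y - x n \<omega>) \<partial>M) = (\<integral>\<omega>. (y - x n \<omega>) \<bullet> mean_grad (x n \<omega>) \<partial>M)" .
qed

lemma correlation_bounded:
  assumes n: "1 \<le> n" and y: "y \<in> X"
  shows "\<bar>\<integral>\<omega>. (y - x n \<omega>) \<bullet> mean_grad (x n \<omega>) \<partial>M\<bar> \<le> diam * (1 + K\<^sup>2)"
proof -
  have [measurable]: "x n \<in> borel_measurable M" "mean_grad \<in> borel_measurable borel"
    by (rule x_measurable, rule mean_grad_measurable)
  have bound: "norm ((y - x n \<omega>) \<bullet> mean_grad (x n \<omega>)) \<le> diam * (1 + K\<^sup>2)" if "\<omega> \<in> space M" for \<omega>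
  proof -
    have "norm (y - x n \<omega>) * norm (mean_grad (x n \<omega>)) \<le> diam * (1 + K\<^sup>2)"
      using x_in_X[OF n that] norm_diff_le_diam[OF y] norm_mean_grad_le diam_nonneg
      by (intro mult_mono) auto
    then show ?thesis
      using Cauchy_Schwarz_ineq2[of "y - x n \<omega>" "mean_grad (x n \<omega>)"] by simp
  qed
  have int: "integrable M (\<lambda>\<omega>. (y - x n \<omega>) \<bullet> mean_grad (x n \<omega>))"
    by (rule integrable_const_bound[where B="diam * (1 + K\<^sup>2)"]) (use bound in auto)
  have "norm (\<integral>\<omega>. (y - x n \<omega>) \<bullet> mean_grad (x n \<omega>) \<partial>M)
      \<le> (\<integral>\<omega>. norm ((y - x n \<omega>) \<bullet> mean_grad (x n \<omega>)) \<partial>M)"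
    by (rule integral_norm_bound)
  also have "\<dots> \<le> (\<integral>\<omega>. diam * (1 + K\<^sup>2) \<partial>M)"
    using int bound by (intro integral_mono) auto
  finally show ?thesis by (simp add: prob_space)
qed

lemma trace_moment:
  "integrable M (\<lambda>\<omega>. \<Sum>i\<in>UNIV. h n \<omega> $ i)" "trace_mean n \<le> B"
proof -
  have [measurable]: "h n \<in> borel_measurable M" by (rule h_measurable)
  have nonneg: "0 \<le> (\<Sum>i\<in>UNIV. h n \<omega> $ i)" if "\<omega> \<in> space M" for \<omega>
    using h_pos[OF that] by (intro sum_nonneg) (simp add: less_imp_le)
  show int: "integrable M (\<lambda>\<omega>. \<Sum>i\<in>UNIV. h n \<omega> $ i)"
    using h_mean[of n] nonneg
    by (intro integrableI_nonneg) (auto simp: le_less_trans[OF _ ennreal_less_top])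
  show "trace_mean n \<le> B"
    using h_mean[of n] nn_integral_eq_integral[OF int] nonneg B_nonneg by (simp add: trace_mean_def)
qed

lemma weighted_sq_moment:
  assumes u: "u \<in> borel_measurable M" "\<And>\<omega>. \<omega> \<in> space M \<Longrightarrow> u \<omega> \<in> X" and y: "y \<in> X"
  shows "integrable M (\<lambda>\<omega>. weighted_sq (h n \<omega>) (u \<omega> - y))"
    and "0 \<le> (\<integral>\<omega>. weighted_sq (h n \<omega>) (u \<omega> - y) \<partial>M)"
    and "(\<integral>\<omega>. weighted_sq (h n \<omega>) (u \<omega> - y) \<partial>M) \<le> D * trace_mean n"
proof -
  have [measurable]: "h n \<in> borel_measurable M" "u \<in> borel_measurable M" by (rule h_measurable, rule u)
  have nonneg: "0 \<le> weighted_sq (h n \<omega>) (u \<omega> - y)" if "\<omega> \<in> space M" for \<omega>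
    unfolding weighted_sq_def using h_pos[OF that] by (intro sum_nonneg) (simp add: less_imp_le)
  have bound: "weighted_sq (h n \<omega>) (u \<omega> - y) \<le> D * (\<Sum>i\<in>UNIV. h n \<omega> $ i)" if "\<omega> \<in> space M" for \<omega>
    unfolding weighted_sq_def sum_distrib_left
    using h_pos[OF that] coord_diam[OF u(2)[OF that] y]
    by (intro sum_mono) (simp add: mult.commute[of D] mult_left_mono less_imp_le)
  have int': "integrable M (\<lambda>\<omega>. D * (\<Sum>i\<in>UNIV. h n \<omega> $ i))"
    using trace_moment(1)[of n] by simp
  then show int: "integrable M (\<lambda>\<omega>. weighted_sq (h n \<omega>) (u \<omega> - y))"
  proof (rule Bochner_Integration.integrable_bound)
    show "AE \<omega> in M. norm (weighted_sq (h n \<omega>) (u \<omega> - y)) \<le> norm (D * (\<Sum>i\<in>UNIV. h n \<omega> $ i))"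
      using nonneg bound by (intro AE_I2) fastforce
  qed (simp add: weighted_sq_def)
  show "0 \<le> (\<integral>\<omega>. weighted_sq (h n \<omega>) (u \<omega> - y) \<partial>M)"
    using nonneg by (intro integral_nonneg_AE) auto
  have "(\<integral>\<omega>. weighted_sq (h n \<omega>) (u \<omega> - y) \<partial>M) \<le> (\<integral>\<omega>. D * (\<Sum>i\<in>UNIV. h n \<omega> $ i) \<partial>M)"
    using int int' bound by (intro integral_mono) auto
  then show "(\<integral>\<omega>. weighted_sq (h n \<omega>) (u \<omega> - y) \<partial>M) \<le> D * trace_mean n"
    by (simp add: trace_mean_def)
qed

section \<open>Expected descent\<close>

text \<open>Expected squared distances to \<open>y\<close> before and after step \<open>n\<close>, both in the metric of step \<open>n\<close>.\<close>

definition dist_before :: "real^'d \<Rightarrow> nat \<Rightarrow> real" where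
  "dist_before y n = (\<integral>\<omega>. weighted_sq (h n \<omega>) (x n \<omega> - y) \<partial>M)"

definition dist_after :: "real^'d \<Rightarrow> nat \<Rightarrow> real" where
  "dist_after y n = (\<integral>\<omega>. weighted_sq (h n \<omega>) (x (Suc n) \<omega> - y) \<partial>M)"

text \<open>The metric only grows, and each coordinate of \<open>x (Suc n) - y\<close> has square at most \<open>D\<close>, so passing
  to the next metric costs at most \<open>D\<close> times the increase of the trace.\<close>

lemma change_of_metric:
  assumes y: "y \<in> X"
  shows "dist_before y (Suc n) \<le> dist_after y n + D * (trace_mean (Suc n) - trace_mean n)"
proof -
  have "AE \<omega> in M. \<forall>i\<in>UNIV. h n \<omega> $ i \<le> h (Suc n) \<omega> $ i"
    using h_mono by (intro AE_finite_allI) auto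
  then have "AE \<omega> in M. weighted_sq (h (Suc n) \<omega>) (x (Suc n) \<omega> - y)
      \<le> weighted_sq (h n \<omega>) (x (Suc n) \<omega> - y)
        + D * ((\<Sum>i\<in>UNIV. h (Suc n) \<omega> $ i) - (\<Sum>i\<in>UNIV. h n \<omega> $ i))"
  proof (rule AE_mp, intro AE_I2 impI)
    fix \<omega> assume \<omega>: "\<omega> \<in> space M" and mono: "\<forall>i\<in>UNIV. h n \<omega> $ i \<le> h (Suc n) \<omega> $ i"
    have "weighted_sq (h (Suc n) \<omega>) (x (Suc n) \<omega> - y) - weighted_sq (h n \<omega>) (x (Suc n) \<omega> - y)
        = (\<Sum>i\<in>UNIV. (h (Suc n) \<omega> $ i - h n \<omega> $ i) * ((x (Suc n) \<omega> - y) $ i)\<^sup>2)"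
      by (simp add: weighted_sq_def sum_subtractf left_diff_distrib)
    also have "\<dots> \<le> (\<Sum>i\<in>UNIV. (h (Suc n) \<omega> $ i - h n \<omega> $ i) * D)"
      using mono coord_diam[OF x_in_X[OF _ \<omega>] y, of "Suc n"]
      by (intro sum_mono mult_left_mono) simp_all
    also have "\<dots> = D * ((\<Sum>i\<in>UNIV. h (Suc n) \<omega> $ i) - (\<Sum>i\<in>UNIV. h n \<omega> $ i))"
      by (simp add: sum_subtractf mult.commute flip: sum_distrib_left)
    finally show "weighted_sq (h (Suc n) \<omega>) (x (Suc n) \<omega> - y)
      \<le> weighted_sq (h n \<omega>) (x (Suc n) \<omega> - y)
        + D * ((\<Sum>i\<in>UNIV. h (Suc n) \<omega> $ i) - (\<Sum>i\<in>UNIV. h n \<omega> $ i))" by simp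
  qed
  moreover have "integrable M (\<lambda>\<omega>. weighted_sq (h k \<omega>) (x (Suc n) \<omega> - y))" for k
    by (rule weighted_sq_moment(1)[OF x_measurable x_in_X y]) simp_all
  ultimately have "dist_before y (Suc n) \<le> (\<integral>\<omega>. weighted_sq (h n \<omega>) (x (Suc n) \<omega> - y)
        + D * ((\<Sum>i\<in>UNIV. h (Suc n) \<omega> $ i) - (\<Sum>i\<in>UNIV. h n \<omega> $ i)) \<partial>M)"
    unfolding dist_before_def using trace_moment(1)
    by (intro integral_mono_AE Bochner_Integration.integrable_add integrable_mult_right
        Bochner_Integration.integrable_diff)
  also have "\<dots> = dist_after y n + D * (trace_mean (Suc n) - trace_mean n)"
    using trace_moment(1) weighted_sq_moment(1)[OF x_measurable x_in_X y, of "Suc n"]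
    by (simp add: dist_after_def trace_mean_def)
  finally show ?thesis .
qed

text \<open>The initial metric is deterministic and later ones dominate it, so its smallest diagonal entry
  bounds every metric from below almost surely.\<close>

definition metric_floor :: real where
  "metric_floor = Min (range (\<lambda>i. h0 $ i))"

lemma metric_floor_pos: "0 < metric_floor"
proof -
  obtain \<omega> where "\<omega> \<in> space M" using not_empty by blast
  then have "0 < h0 $ i" for i using h_pos[of \<omega> 0 i] h_0 by simp
  then show ?thesis by (simp add: metric_floor_def)
qed

lemma h_ge_metric_floor: "AE \<omega> in M. \<forall>i. metric_floor \<le> h n \<omega> $ i"
proof (induction n)
  case 0
  show ?case by (rule AE_I2) (simp add: h_0 metric_floor_def)
next
  case (Suc n)
  have "AE \<omega> in M. \<forall>i\<in>UNIV. h n \<omega> $ i \<le> h (Suc n) \<omega> $ i"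
    using h_mono by (intro AE_finite_allI) auto
  with Suc show ?case
    by eventually_elim (blast intro: order_trans)
qed

text \<open>The error coefficients of one step: \<open>drift\<close> comes from the stale momentum, \<open>noise\<close> from the squared
  fresh gradient.\<close>

definition drift :: real where
  "drift = 2 * diam * momentum_bound / (1 - \<gamma>)"

definition noise :: real where
  "noise = K\<^sup>2 / ((1 - \<gamma>)\<^sup>2 * metric_floor)"

lemma drift_noise_nonneg: "0 \<le> drift" "0 \<le> noise"
proof -
  have "0 \<le> momentum_bound" by (simp add: momentum_bound_def le_max_iff_disj)
  then show "0 \<le> drift" using gamma diam_nonneg by (simp add: drift_def)
  show "0 \<le> noise" using metric_floor_pos by (simp add: noise_def)
qed

text \<open>\<open>projected_step_descent\<close> along one sample path. The inner product of the fresh gradient is kept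
  exact, since its mean is the quantity of interest; the other two terms are replaced by norms, whose
  means are bounded.\<close>

lemma pathwise_descent:
  assumes n: "1 \<le> n" and y: "y \<in> X" and \<alpha>: "0 \<le> \<alpha> n" and \<omega>: "\<omega> \<in> space M"
    and floor: "\<forall>i. metric_floor \<le> h n \<omega> $ i"
  shows "weighted_sq (h n \<omega>) (x (Suc n) \<omega> - y) \<le> weighted_sq (h n \<omega>) (x n \<omega> - y)
    + 2 * \<alpha> n * (1 - \<beta> n) / bias_corr n * (sample n \<omega> \<bullet> (y - x n \<omega>))
    + 2 * \<alpha> n * \<beta> n * (diam / (1 - \<gamma>)) * norm (m (n - 1) \<omega>)
    + (\<alpha> n)\<^sup>2 * (1 / ((1 - \<gamma>)\<^sup>2 * metric_floor)) * (norm (sample n \<omega>))\<^sup>2"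
proof -
  let ?S = "sample n \<omega>" and ?m = "m (n - 1) \<omega>" and ?c = "bias_corr n"
  define g where "g = ((1 - \<beta> n) / ?c) *\<^sub>R ?S"
  define e where "e = (\<beta> n / ?c) *\<^sub>R ?m"
  have dir: "diag_matrix (h n \<omega>) *v d n \<omega> = - (g + e)"
    using direction[OF \<omega>, of n] m_Suc[OF \<omega>, of "n - 1"] n
    by (simp add: g_def e_def bias_corr_def scaleR_add_right add.commute)
  have step: "weighted_sq (h n \<omega>) (x (Suc n) \<omega> - y) \<le> weighted_sq (h n \<omega>) (x n \<omega> - y)
      + 2 * \<alpha> n * (g \<bullet> (y - x n \<omega>)) + 2 * \<alpha> n * (e \<bullet> (y - x (Suc n) \<omega>))
      + (\<alpha> n)\<^sup>2 * (\<Sum>i\<in>UNIV. (g $ i)\<^sup>2 / h n \<omega> $ i)"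
    using projected_step_descent[OF X h_pos[OF \<omega>] dir y, of "x n \<omega>" "\<alpha> n"] x_Suc[OF \<omega>, of n] by simp
  have "e \<bullet> (y - x (Suc n) \<omega>) \<le> norm e * norm (y - x (Suc n) \<omega>)"
    by (rule norm_cauchy_schwarz)
  also have "\<dots> \<le> (\<beta> n / (1 - \<gamma>) * norm ?m) * diam"
  proof (rule mult_mono)
    have "\<beta> n / ?c \<le> \<beta> n / (1 - \<gamma>)"
      using bias_corr_bounds[of n] gamma beta[of n] by (intro divide_left_mono) auto
    then show "norm e \<le> \<beta> n / (1 - \<gamma>) * norm ?m"
      using bias_corr_bounds(2)[of n] beta(1)[of n] unfolding e_def norm_scaleR
      by (intro mult_right_mono) auto
    show "norm (y - x (Suc n) \<omega>) \<le> diam"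
      by (rule norm_diff_le_diam[OF y x_in_X]) (use \<omega> in auto)
  qed (use gamma beta[of n] in auto)
  finally have momentum: "e \<bullet> (y - x (Suc n) \<omega>) \<le> \<beta> n * (diam / (1 - \<gamma>)) * norm ?m"
    by (simp add: mult.commute mult.left_commute)
  have "(\<Sum>i\<in>UNIV. (g $ i)\<^sup>2 / h n \<omega> $ i) \<le> (\<Sum>i\<in>UNIV. (g $ i)\<^sup>2 / metric_floor)"
    using floor metric_floor_pos h_pos[OF \<omega>] by (intro sum_mono divide_left_mono) auto
  also have "\<dots> = (norm g)\<^sup>2 / metric_floor"
    unfolding power2_norm_eq_inner inner_vec_def
    by (simp add: sum_divide_distrib power2_eq_square)
  also have "\<dots> \<le> (1 / (1 - \<gamma>) * norm ?S)\<^sup>2 / metric_floor"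
  proof -
    have "(1 - \<beta> n) / ?c \<le> 1 / (1 - \<gamma>)"
      using bias_corr_bounds[of n] gamma beta[of n] by (intro frac_le) auto
    then have "norm g \<le> 1 / (1 - \<gamma>) * norm ?S"
      using bias_corr_bounds(2)[of n] beta(2)[of n] unfolding g_def norm_scaleR
      by (intro mult_right_mono) auto
    then show ?thesis
      using metric_floor_pos by (intro divide_right_mono power_mono) auto
  qed
  also have "\<dots> = 1 / ((1 - \<gamma>)\<^sup>2 * metric_floor) * (norm ?S)\<^sup>2"
    by (simp add: power_mult_distrib power_divide)
  finally have grad: "(\<Sum>i\<in>UNIV. (g $ i)\<^sup>2 / h n \<omega> $ i) \<le> 1 / ((1 - \<gamma>)\<^sup>2 * metric_floor) * (norm ?S)\<^sup>2" .
  have "2 * \<alpha> n * (e \<bullet> (y - x (Suc n) \<omega>)) \<le> 2 * \<alpha> n * (\<beta> n * (diam / (1 - \<gamma>)) * norm ?m)"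
    using \<alpha> momentum by (intro mult_left_mono) auto
  moreover have "(\<alpha> n)\<^sup>2 * (\<Sum>i\<in>UNIV. (g $ i)\<^sup>2 / h n \<omega> $ i)
      \<le> (\<alpha> n)\<^sup>2 * (1 / ((1 - \<gamma>)\<^sup>2 * metric_floor) * (norm ?S)\<^sup>2)"
    using grad by (intro mult_left_mono) auto
  moreover have "2 * \<alpha> n * (g \<bullet> (y - x n \<omega>)) = 2 * \<alpha> n * (1 - \<beta> n) / ?c * (?S \<bullet> (y - x n \<omega>))"
    by (simp add: g_def)
  ultimately show ?thesis using step by (simp add: mult.assoc)
qed

lemma expected_descent:
  assumes n: "1 \<le> n" and y: "y \<in> X" and \<alpha>: "0 \<le> \<alpha> n"
  shows "2 * \<alpha> n * (1 - \<beta> n) / bias_corr n * - (\<integral>\<omega>. (y - x n \<omega>) \<bullet> mean_grad (x n \<omega>) \<partial>M)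
    \<le> dist_before y n - dist_after y n + drift * (\<alpha> n * \<beta> n) + noise * (\<alpha> n)\<^sup>2"
proof -
  let ?a = "2 * \<alpha> n * (1 - \<beta> n) / bias_corr n" and ?b = "2 * \<alpha> n * \<beta> n * (diam / (1 - \<gamma>))"
    and ?k = "(\<alpha> n)\<^sup>2 * (1 / ((1 - \<gamma>)\<^sup>2 * metric_floor))"
  have ints: "integrable M (\<lambda>\<omega>. weighted_sq (h n \<omega>) (x (Suc n) \<omega> - y))"
      "integrable M (\<lambda>\<omega>. weighted_sq (h n \<omega>) (x n \<omega> - y))"
    using n by (auto intro!: weighted_sq_moment(1) x_measurable x_in_X y)
  note more_ints = mean_grad_correlation(1)[OF n y] momentum_first_moment(1)[of "n - 1"]
    sample_second_moment(1)[OF n]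
  have "dist_after y n \<le> (\<integral>\<omega>. weighted_sq (h n \<omega>) (x n \<omega> - y)
      + ?a * (sample n \<omega> \<bullet> (y - x n \<omega>)) + ?b * norm (m (n - 1) \<omega>) + ?k * (norm (sample n \<omega>))\<^sup>2 \<partial>M)"
    unfolding dist_after_def
  proof (rule integral_mono_AE)
    show "AE \<omega> in M. weighted_sq (h n \<omega>) (x (Suc n) \<omega> - y) \<le> weighted_sq (h n \<omega>) (x n \<omega> - y)
      + ?a * (sample n \<omega> \<bullet> (y - x n \<omega>)) + ?b * norm (m (n - 1) \<omega>) + ?k * (norm (sample n \<omega>))\<^sup>2"
      using h_ge_metric_floor[of n] AE_space
      by eventually_elim (rule pathwise_descent[OF n y \<alpha>])
  qed (use ints more_ints in \<open>auto intro!: Bochner_Integration.integrable_add integrable_mult_right integrable_norm\<close>)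
  also have "\<dots> = dist_before y n + ?a * (\<integral>\<omega>. (y - x n \<omega>) \<bullet> mean_grad (x n \<omega>) \<partial>M)
      + ?b * (\<integral>\<omega>. norm (m (n - 1) \<omega>) \<partial>M) + ?k * (\<integral>\<omega>. (norm (sample n \<omega>))\<^sup>2 \<partial>M)"
    using ints more_ints mean_grad_correlation(2)[OF n y] by (simp add: dist_before_def)
  also have "\<dots> \<le> dist_before y n + ?a * (\<integral>\<omega>. (y - x n \<omega>) \<bullet> mean_grad (x n \<omega>) \<partial>M)
      + ?b * momentum_bound + ?k * K\<^sup>2"
    using \<alpha> beta[of n] gamma diam_nonneg metric_floor_pos
    by (intro add_mono mult_left_mono momentum_first_moment(2) sample_second_moment(2)[OF n] order_refl)
       auto
  finally show ?thesis
    by (simp add: drift_def noise_def algebra_simps)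
qed


section \<open>Asymptotic conclusions\<close>

lemma weighted_distance_sum:
  assumes y: "y \<in> X" and a: "\<And>k. 1 \<le> k \<Longrightarrow> 0 \<le> a k" "\<And>k. 1 \<le> k \<Longrightarrow> a k \<le> a (Suc k)"
    and n: "1 \<le> n"
  shows "(\<Sum>k=1..n. a k * (dist_before y k - dist_after y k)) \<le> D * B * a n"
proof -
  have "(\<Sum>k=1..n. a k * (dist_before y k - dist_after y k)) \<le> D * a n * trace_mean n"
  proof (rule weighted_telescope[where a = a, OF _ _ _ _ a n])
    show "dist_before y 1 \<le> D * trace_mean 1"
      unfolding dist_before_def by (rule weighted_sq_moment(3)[OF x_measurable x_in_X y]) simp_all
    show "dist_before y (Suc k) \<le> dist_after y k + D * (trace_mean (Suc k) - trace_mean k)" for k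
      by (rule change_of_metric[OF y])
    show "0 \<le> dist_after y k" "dist_after y k \<le> D * trace_mean k" for k
      unfolding dist_after_def
      by (rule weighted_sq_moment(2,3)[OF x_measurable x_in_X y]; simp)+
  qed
  also have "\<dots> \<le> D * a n * B"
    using trace_moment(2) D_nonneg a(1)[OF n] by (intro mult_left_mono) auto
  finally show ?thesis by (simp add: mult_ac)
qed

text \<open>If the limes superior were negative, the left-hand sides in \<open>expected_descent\<close> would eventually
  exceed a positive multiple of \<open>\<alpha> n * (1 - \<beta> n)\<close>, whose sum diverges, whereas their partial sums are
  bounded above.\<close>

lemma limsup_correlation_nonneg:
  assumes y: "y \<in> X" and \<alpha>: "\<And>n. 0 < \<alpha> n"
    and div: "filterlim (\<lambda>N. \<Sum>n<N. \<alpha> n) at_top sequentially"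
    and sq: "summable (\<lambda>n. (\<alpha> n)\<^sup>2)" and ab: "summable (\<lambda>n. \<alpha> n * \<beta> n)"
  shows "limsup (\<lambda>n. ereal (\<integral>\<omega>. (y - x n \<omega>) \<bullet> mean_grad (x n \<omega>) \<partial>M)) \<ge> 0"
proof (rule ccontr)
  let ?T = "\<lambda>n. \<integral>\<omega>. (y - x n \<omega>) \<bullet> mean_grad (x n \<omega>) \<partial>M"
  assume "\<not> ?thesis"
  then have "limsup (\<lambda>n. ereal (?T n)) < 0" by simp
  then obtain r where r: "limsup (\<lambda>n. ereal (?T n)) < ereal r" "ereal r < 0"
    using ereal_dense2 by blast
  define e where "e = - r"
  have e: "0 < e" using r by (simp add: e_def zero_ereal_def)
  have "eventually (\<lambda>n. ereal (?T n) < ereal r) sequentially"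
    using r(1) by (rule Limsup_lessD)
  then obtain N where N: "\<And>n. N \<le> n \<Longrightarrow> ?T n \<le> - e"
    by (auto simp: eventually_sequentially e_def intro: less_imp_le)
  \<comment> \<open>The excess over the supposed lower bound: eventually nonnegative, so its partial sums are bounded below.\<close>
  define w where "w k = 2 * \<alpha> k * (1 - \<beta> k) / bias_corr k * - ?T k - 2 * e * (\<alpha> k - \<alpha> k * \<beta> k)" for k
  have w_nonneg: "0 \<le> w k" if "N \<le> k" for k
  proof -
    let ?p = "2 * \<alpha> k * (1 - \<beta> k)"
    have p: "0 \<le> ?p" using \<alpha>[of k] beta[of k] by simp
    have "?p * 1 \<le> ?p * (1 / bias_corr k)"
      using p bias_corr_bounds[of k] by (intro mult_left_mono) auto
    moreover have "e \<le> - ?T k" using N[OF that] by simp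
    ultimately have "?p * e \<le> ?p / bias_corr k * - ?T k"
      using p e by (intro mult_mono) auto
    then show ?thesis by (simp add: w_def algebra_simps)
  qed
  let ?Q = "D * B + drift * (\<Sum>n. \<alpha> n * \<beta> n) + noise * (\<Sum>n. (\<alpha> n)\<^sup>2)"
  have descent: "(\<Sum>k=1..n. 2 * \<alpha> k * (1 - \<beta> k) / bias_corr k * - ?T k) \<le> ?Q" if n: "1 \<le> n" for n
  proof -
    have "(\<Sum>k=1..n. 2 * \<alpha> k * (1 - \<beta> k) / bias_corr k * - ?T k)
        \<le> (\<Sum>k=1..n. dist_before y k - dist_after y k + drift * (\<alpha> k * \<beta> k) + noise * (\<alpha> k)\<^sup>2)"
      using \<alpha> by (intro sum_mono expected_descent y) (auto simp: less_imp_le)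
    also have "\<dots> = (\<Sum>k=1..n. 1 * (dist_before y k - dist_after y k))
        + drift * (\<Sum>k=1..n. \<alpha> k * \<beta> k) + noise * (\<Sum>k=1..n. (\<alpha> k)\<^sup>2)"
      by (simp add: sum.distrib sum_distrib_left)
    also have "\<dots> \<le> D * B * 1 + drift * (\<Sum>n. \<alpha> n * \<beta> n) + noise * (\<Sum>n. (\<alpha> n)\<^sup>2)"
      using \<alpha> beta sq ab drift_noise_nonneg n
      by (intro add_mono mult_left_mono weighted_distance_sum y sum_le_suminf) (auto simp: less_imp_le)
    finally show ?thesis by simp
  qed
  let ?W = "\<Sum>k=1..N. w k"
  let ?R = "\<alpha> 0 + (?Q - ?W + 2 * e * (\<Sum>n. \<alpha> n * \<beta> n)) / (2 * e)"
  have bounded: "(\<Sum>k<Suc n. \<alpha> k) \<le> ?R" if n: "max 1 N \<le> n" for n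
  proof -
    have "?W \<le> (\<Sum>k=1..n. w k)"
      using n w_nonneg by (intro sum_mono2) auto
    also have "\<dots> = (\<Sum>k=1..n. 2 * \<alpha> k * (1 - \<beta> k) / bias_corr k * - ?T k)
        - 2 * e * ((\<Sum>k=1..n. \<alpha> k) - (\<Sum>k=1..n. \<alpha> k * \<beta> k))"
      by (simp only: w_def sum_subtractf sum_distrib_left[symmetric])
    finally have "2 * e * (\<Sum>k=1..n. \<alpha> k) \<le> ?Q - ?W + 2 * e * (\<Sum>k=1..n. \<alpha> k * \<beta> k)"
      using descent[of n] n by (simp add: right_diff_distrib)
    also have "\<dots> \<le> ?Q - ?W + 2 * e * (\<Sum>n. \<alpha> n * \<beta> n)"
      using e \<alpha> beta ab by (intro add_left_mono mult_left_mono sum_le_suminf) (auto simp: less_imp_le)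
    finally have "(\<Sum>k=1..n. \<alpha> k) \<le> (?Q - ?W + 2 * e * (\<Sum>n. \<alpha> n * \<beta> n)) / (2 * e)"
      using e by (subst pos_le_divide_eq) (simp_all add: mult.commute)
    moreover have "(\<Sum>k<Suc n. \<alpha> k) = \<alpha> 0 + (\<Sum>k=1..n. \<alpha> k)"
      by (simp add: sum.lessThan_Suc_shift sum.atLeast1_atMost_eq del: sum.lessThan_Suc)
    ultimately show ?thesis by simp
  qed
  have "eventually (\<lambda>n. ?R + 1 \<le> (\<Sum>k<n. \<alpha> k)) sequentially"
    using div by (simp add: filterlim_at_top)
  then obtain m where m: "\<And>n. m \<le> n \<Longrightarrow> ?R + 1 \<le> (\<Sum>k<n. \<alpha> k)"
    by (auto simp: eventually_sequentially)
  have "?R + 1 \<le> (\<Sum>k<Suc (max m (max 1 N)). \<alpha> k)"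
    by (rule m) (rule le_SucI[OF max.cobounded1])
  also have "\<dots> \<le> ?R" by (rule bounded) simp
  finally show False by simp
qed

text \<open>Dividing \<open>expected_descent\<close> by \<open>2 * \<alpha> k / bias_corr k\<close> isolates the correlation and puts weights of
  order \<open>k powr \<eta>\<close> on the telescoping distances. The weights increase, so these distances contribute
  \<open>O(n powr \<eta>)\<close>. The geometric momentum errors are summable and the noise errors sum to
  \<open>O(n powr \<eta>)\<close> as well.\<close>

lemma average_correlation_rate:
  assumes y: "y \<in> X" and \<eta>: "1 / 2 \<le> \<eta>" and lam: "0 < lam" "lam < 1"
    and \<alpha>: "\<And>n. 1 \<le> n \<Longrightarrow> \<alpha> n = 1 / real n powr \<eta>" and \<beta>: "\<And>n. 1 \<le> n \<Longrightarrow> \<beta> n = lam ^ n"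
  shows "\<exists>C. \<forall>n\<ge>1. - (C / real n powr (1 - \<eta>))
    \<le> 1 / real n * (\<Sum>k=1..n. \<integral>\<omega>. (y - x k \<omega>) \<bullet> mean_grad (x k \<omega>) \<partial>M)"
proof -
  let ?T = "\<lambda>n. \<integral>\<omega>. (y - x n \<omega>) \<bullet> mean_grad (x n \<omega>) \<partial>M"
  let ?R = "diam * (1 + K\<^sup>2)"
  define a where "a k = bias_corr k * real k powr \<eta> / 2" for k
  have a_nonneg: "0 \<le> a k" for k
    using bias_corr_bounds(2)[of k] by (simp add: a_def)
  have a_mono: "a k \<le> a (Suc k)" for k
    unfolding a_def using \<eta> bias_corr_bounds(2)[of "Suc k"]
    by (intro divide_right_mono mult_mono bias_corr_bounds(4) powr_mono2) (auto simp: less_imp_le)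
  have R: "0 \<le> ?R" using diam_nonneg by simp
  \<comment> \<open>The factor \<open>1 - \<beta> k\<close> is not divided out, since that could spoil the monotonicity of the weights. The missing part
    \<open>\<beta> k * - ?T k\<close> is of order \<open>lam ^ k\<close> because the correlations are bounded.\<close>
  have each: "- ?T k \<le> a k * (dist_before y k - dist_after y k) + (?R + drift / 2) * lam ^ k + noise / 2 * \<alpha> k"
    if k: "1 \<le> k" for k
  proof -
    have p: "0 < real k powr \<eta>" using k by simp
    have a\<alpha>: "a k * \<alpha> k = bias_corr k / 2"
      using p by (simp add: a_def \<alpha>[OF k])
    have pos: "0 \<le> \<alpha> k" by (simp add: \<alpha>[OF k])
    have "(1 - \<beta> k) * - ?T k = a k * (2 * \<alpha> k * (1 - \<beta> k) / bias_corr k * - ?T k)"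
    proof -
      have "a k * (2 * \<alpha> k * (1 - \<beta> k) / bias_corr k * - ?T k)
          = (a k * \<alpha> k) * (2 * (1 - \<beta> k) / bias_corr k * - ?T k)" by simp
      also have "\<dots> = (1 - \<beta> k) * - ?T k"
        unfolding a\<alpha> using bias_corr_bounds(2)[of k] by simp
      finally show ?thesis ..
    qed
    also have "\<dots> \<le> a k * (dist_before y k - dist_after y k + drift * (\<alpha> k * \<beta> k) + noise * (\<alpha> k)\<^sup>2)"
      by (intro mult_left_mono expected_descent k y pos a_nonneg)
    also have "\<dots> = a k * (dist_before y k - dist_after y k) + (a k * \<alpha> k) * (drift * \<beta> k + noise * \<alpha> k)"
      by (simp add: algebra_simps power2_eq_square)
    also have "\<dots> \<le> a k * (dist_before y k - dist_after y k) + 1 / 2 * (drift * \<beta> k + noise * \<alpha> k)"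
      unfolding a\<alpha> using bias_corr_bounds(3)[of k] drift_noise_nonneg beta(1)[of k] pos
      by (intro add_left_mono mult_right_mono) auto
    finally have "(1 - \<beta> k) * - ?T k \<le> a k * (dist_before y k - dist_after y k)
        + 1 / 2 * (drift * \<beta> k + noise * \<alpha> k)" .
    moreover have "\<beta> k * - ?T k \<le> \<beta> k * ?R"
      using beta(1)[of k] correlation_bounded[OF k y] by (intro mult_left_mono) auto
    ultimately have "(1 - \<beta> k) * - ?T k + \<beta> k * - ?T k \<le> a k * (dist_before y k - dist_after y k)
        + 1 / 2 * (drift * \<beta> k + noise * \<alpha> k) + \<beta> k * ?R" by linarith
    then show ?thesis by (simp add: \<beta>[OF k] algebra_simps)
  qed
  let ?C = "D * B / 2 + (?R + drift / 2) / (1 - lam) + noise"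
  have "- (?C / real n powr (1 - \<eta>)) \<le> 1 / real n * (\<Sum>k=1..n. ?T k)"
    if n: "1 \<le> n" for n :: nat
  proof -
    let ?p = "real n powr \<eta>"
    have p1: "1 \<le> ?p" using n \<eta> by (intro ge_one_powr_ge_zero) auto
    have "- (\<Sum>k=1..n. ?T k) = (\<Sum>k=1..n. - ?T k)"
      by (simp add: sum_negf)
    also have "\<dots> \<le> (\<Sum>k=1..n. a k * (dist_before y k - dist_after y k) + (?R + drift / 2) * lam ^ k + noise / 2 * \<alpha> k)"
      by (intro sum_mono each) simp
    also have "\<dots> = (\<Sum>k=1..n. a k * (dist_before y k - dist_after y k))
        + (?R + drift / 2) * (\<Sum>k=1..n. lam ^ k) + noise / 2 * (\<Sum>k=1..n. \<alpha> k)"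
      by (simp add: sum.distrib sum_distrib_left)
    also have "\<dots> \<le> D * B * (?p / 2) + (?R + drift / 2) * (?p / (1 - lam)) + noise / 2 * (2 * ?p)"
    proof (intro add_mono mult_left_mono)
      have "(\<Sum>k=1..n. a k * (dist_before y k - dist_after y k)) \<le> D * B * a n"
        using a_nonneg a_mono n by (intro weighted_distance_sum y) auto
      also have "\<dots> \<le> D * B * (?p / 2)"
        using D_nonneg B_nonneg bias_corr_bounds(2,3)[of n] p1
        by (intro mult_left_mono) (auto simp: a_def mult_left_le_one_le less_imp_le)
      finally show "(\<Sum>k=1..n. a k * (dist_before y k - dist_after y k)) \<le> D * B * (?p / 2)" .
      have "(\<Sum>k=1..n. lam ^ k) \<le> (\<Sum>k. lam ^ k)"
        using lam by (intro sum_le_suminf summable_geometric) auto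
      also have "\<dots> = 1 / (1 - lam)"
        using lam by (intro suminf_geometric) auto
      also have "\<dots> \<le> ?p / (1 - lam)"
        using lam p1 by (intro divide_right_mono) auto
      finally show "(\<Sum>k=1..n. lam ^ k) \<le> ?p / (1 - lam)" .
      have "(\<Sum>k=1..n. \<alpha> k) = (\<Sum>k=1..n. 1 / real k powr \<eta>)"
        using \<alpha> by (intro sum.cong) auto
      also have "\<dots> \<le> 2 * ?p"
        by (rule sum_inverse_powr_le[OF \<eta>])
      finally show "(\<Sum>k=1..n. \<alpha> k) \<le> 2 * ?p" .
    qed (use R drift_noise_nonneg in auto)
    also have "\<dots> = ?C * ?p"
    proof -
      have "D * B * (p / 2) + r * (p / q) + noise / 2 * (2 * p) = (D * B / 2 + r / q + noise) * p"
        for p q r :: real by (simp add: distrib_right)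
      then show ?thesis .
    qed
    finally have "- (\<Sum>k=1..n. ?T k) \<le> ?C * ?p" .
    then have "1 / real n * - (\<Sum>k=1..n. ?T k) \<le> 1 / real n * (?C * ?p)"
      by (intro mult_left_mono) auto
    also have "\<dots> = ?C / real n powr (1 - \<eta>)"
      using n by (simp add: powr_diff)
    finally show ?thesis
      by simp
  qed
  then show ?thesis by blast
qed

end

section \<open>The convergence theorem\<close>

lemma finite_max_sup_bound:
  fixes X :: "(real^'d) set"
  assumes "(MAX i. SUP (y, z)\<in>X \<times> X. ereal ((y $ i - z $ i)\<^sup>2)) < \<infinity>"
  obtains D where "\<And>y z i. y \<in> X \<Longrightarrow> z \<in> X \<Longrightarrow> (y $ i - z $ i)\<^sup>2 \<le> D"
proof -
  let ?S = "\<lambda>i. SUP (y, z)\<in>X \<times> X. ereal ((y $ i - z $ i)\<^sup>2)"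
  obtain D where D: "Max (range ?S) \<le> ereal D"
    using ereal_dense2[OF assms] less_imp_le by blast
  show thesis
  proof
    fix y z i assume "y \<in> X" "z \<in> X"
    then have "ereal ((y $ i - z $ i)\<^sup>2) \<le> ?S i"
      by (intro SUP_upper2[of "(y, z)"]) auto
    also have "\<dots> \<le> Max (range ?S)" by (rule Max_ge) auto
    also note D
    finally show "(y $ i - z $ i)\<^sup>2 \<le> D" by simp
  qed
qed
theorem theorem3p2:
  fixes X :: "(real^'d) set"
    and P :: "(real^'e) measure" and \<Xi> :: "(real^'e) set"
    and F :: "real^'d \<Rightarrow> real^'e \<Rightarrow> real" and f :: "real^'d \<Rightarrow> real"
    and G :: "real^'d \<Rightarrow> real^'e \<Rightarrow> real^'d"
    and M :: "'w measure" and \<xi> :: "nat \<Rightarrow> 'w \<Rightarrow> real^'e"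
    and h :: "nat \<Rightarrow> 'w \<Rightarrow> real^'d" and x :: "nat \<Rightarrow> 'w \<Rightarrow> real^'d"
    and x0 m_init h0 :: "real^'d"
    and \<alpha> \<beta> :: "nat \<Rightarrow> real" and \<gamma> :: real
  assumes "prob_space P" and "sets P = sets borel" and "AE s in P. s \<in> \<Xi>"
    and A1: "X \<noteq> {}" "closed X" "convex X"
    and A2: "\<And>y. integrable P (F y)" "\<And>y. f y = (\<integral>s. F y s \<partial>P)"
      "AE s in P. s \<in> \<Xi> \<longrightarrow>
         (\<forall>y. (\<lambda>z. F z s) differentiable (at y)) \<and> continuous_on UNIV (grad (\<lambda>z. F z s))"
    and A5: "(MAX i. SUP (y, z)\<in>X \<times> X. ereal ((y $ i - z $ i)\<^sup>2)) < \<infinity>"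
    and C2: "(\<lambda>(y, s). G y s) \<in> borel_measurable (borel \<Otimes>\<^sub>M borel)"
      "\<And>y. integrable P (G y)" "\<And>y. f differentiable (at y)"
      "\<And>y. (\<integral>s. G y s \<partial>P) = grad f y"
    and C3: "\<exists>K>0. \<forall>y\<in>X. (\<integral>\<^sup>+s. ennreal ((norm (G y s))\<^sup>2) \<partial>P) \<le> ennreal (K\<^sup>2)"
    and "prob_space M"
    and C1: "prob_space.indep_vars M (\<lambda>_. borel) \<xi> UNIV" "\<And>n. distr M borel (\<xi> n) = P"
    and beta: "\<And>n. 0 \<le> \<beta> n" "\<And>n. \<beta> n < 1"
    and gamma: "0 \<le> \<gamma>" "\<gamma> < 1"
    and algorithm: "\<And>\<omega>. \<omega> \<in> space M \<Longrightarrow>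
      algorithm_path X G \<alpha> \<beta> \<gamma> x0 m_init h0 (\<lambda>n. \<xi> n \<omega>) (\<lambda>n. h n \<omega>) (\<lambda>n. x n \<omega>)"
    and h_measurable: "\<And>n. h n \<in> borel_measurable M"
    and x_history: "\<And>n. \<exists>\<phi>\<in>borel_measurable (\<Pi>\<^sub>M k\<in>{..<n}. (borel :: (real^'e) measure)).
      \<forall>\<omega>\<in>space M. x n \<omega> = \<phi> (\<lambda>k\<in>{..<n}. \<xi> k \<omega>)"
    and A3: "\<And>n i. AE \<omega> in M. h (n + 1) \<omega> $ i \<ge> h n \<omega> $ i"
    and A4: "\<And>i. \<exists>B>0. (SUP n. \<integral>\<^sup>+\<omega>. ennreal (h n \<omega> $ i) \<partial>M) \<le> ennreal B"
  shows "((\<forall>n. 0 < \<alpha> n \<and> \<alpha> n < 1) \<and>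
      filterlim (\<lambda>N. \<Sum>n<N. \<alpha> n) at_top sequentially \<and>
      summable (\<lambda>n. (\<alpha> n)\<^sup>2) \<and> summable (\<lambda>n. \<alpha> n * \<beta> n) \<longrightarrow>
      (\<forall>y\<in>X. limsup (\<lambda>n. ereal (\<integral>\<omega>. (y - x n \<omega>) \<bullet> grad f (x n \<omega>) \<partial>M)) \<ge> 0))
    \<and>
    (\<forall>\<eta> lam. 1/2 \<le> \<eta> \<and> \<eta> < 1 \<and> 0 < lam \<and> lam < 1 \<and> 0 < \<alpha> 0 \<and> \<alpha> 0 < 1 \<and>
      (\<forall>n\<ge>1. \<alpha> n = 1 / real n powr \<eta>) \<and> (\<forall>n\<ge>1. \<beta> n = lam ^ n) \<longrightarrow>
      (\<forall>y\<in>X. \<exists>r. r \<in> O(\<lambda>n. 1 / real n powr (1 - \<eta>)) \<and>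
        (\<forall>n\<ge>1. 1 / real n * (\<Sum>k=1..n. \<integral>\<omega>. (y - x k \<omega>) \<bullet> grad f (x k \<omega>) \<partial>M) \<ge> - r n)))"
proof -
  interpret prob_space M by fact
  obtain D where D: "\<And>y z i. y \<in> X \<Longrightarrow> z \<in> X \<Longrightarrow> (y $ i - z $ i)\<^sup>2 \<le> D"
    using finite_max_sup_bound[OF A5] by blast
  obtain K where K: "\<And>y. y \<in> X \<Longrightarrow> (\<integral>\<^sup>+s. ennreal ((norm (G y s))\<^sup>2) \<partial>P) \<le> ennreal (K\<^sup>2)"
    using C3 by blast
  from A4 obtain b where b: "\<And>i. b i > 0" "\<And>i. (SUP n. \<integral>\<^sup>+\<omega>. ennreal (h n \<omega> $ i) \<partial>M) \<le> ennreal (b i)"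
    by metis
  have h_pos: "h n \<omega> $ i > 0" if "\<omega> \<in> space M" for n \<omega> i
    using algorithm[OF that] by (simp add: algorithm_path_def)
  \<comment> \<open>The auxiliary processes are given path by path and have to be chosen jointly in \<open>\<omega>\<close>.\<close>
  define run where "run \<omega> m d \<longleftrightarrow> (\<forall>n.
      m n = \<beta> n *\<^sub>R (if n = 0 then m_init else m (n - 1)) + (1 - \<beta> n) *\<^sub>R G (x n \<omega>) (\<xi> n \<omega>) \<and>
      diag_matrix (h n \<omega>) *v d n = - ((1 / (1 - \<gamma> ^ (n + 1))) *\<^sub>R m n) \<and>
      x (n + 1) \<omega> = metric_proj X (diag_matrix (h n \<omega>)) (x n \<omega> + \<alpha> n *\<^sub>R d n))" for \<omega> m d
  have "\<exists>m d. run \<omega> m d" if \<omega>: "\<omega> \<in> space M" for \<omega>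
  proof -
    obtain m mhat d where "\<forall>n.
        m n = \<beta> n *\<^sub>R (if n = 0 then m_init else m (n - 1)) + (1 - \<beta> n) *\<^sub>R G (x n \<omega>) (\<xi> n \<omega>) \<and>
        mhat n = (1 / (1 - \<gamma> ^ (n + 1))) *\<^sub>R m n \<and>
        diag_matrix (h n \<omega>) *v d n = - mhat n \<and>
        x (n + 1) \<omega> = metric_proj X (diag_matrix (h n \<omega>)) (x n \<omega> + \<alpha> n *\<^sub>R d n)"
      using algorithm[OF \<omega>] unfolding algorithm_path_def by blast
    then have "run \<omega> m d" unfolding run_def by metis
    then show ?thesis by blast
  qed
  then obtain m d where run: "\<And>\<omega>. \<omega> \<in> space M \<Longrightarrow> run \<omega> (m \<omega>) (d \<omega>)"
    by metis
  note path = run[unfolded run_def, THEN spec]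
  interpret A: adaptive_method M X P G \<xi> h x "\<lambda>n \<omega>. m \<omega> n" "\<lambda>n \<omega>. d \<omega> n" x0 m_init h0 \<alpha> \<beta> \<gamma> D K "\<Sum>i\<in>UNIV. b i"
  proof (intro adaptive_method.intro adaptive_method_axioms.intro)
    fix n
    obtain \<phi> where "\<phi> \<in> borel_measurable (\<Pi>\<^sub>M k\<in>{..<n}. (borel :: (real^'e) measure))"
        "\<And>\<omega>. \<omega> \<in> space M \<Longrightarrow> x n \<omega> = \<phi> (\<lambda>k\<in>{..<n}. \<xi> k \<omega>)"
      using x_history[of n] by blast
    from joint_law_past_sample[OF C1(1) this]
    show "x n \<in> borel_measurable M"
      and "distr M (borel \<Otimes>\<^sub>M borel) (\<lambda>\<omega>. (x n \<omega>, \<xi> n \<omega>)) = distr M borel (x n) \<Otimes>\<^sub>M P"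
      by (simp_all add: C1(2))
    show "\<xi> n \<in> borel_measurable M"
      using C1(1) by (simp add: indep_vars_def)
    have "(\<integral>\<^sup>+\<omega>. ennreal (\<Sum>i\<in>UNIV. h n \<omega> $ i) \<partial>M) = (\<integral>\<^sup>+\<omega>. (\<Sum>i\<in>UNIV. ennreal (h n \<omega> $ i)) \<partial>M)"
      using h_pos by (intro nn_integral_cong) (simp add: sum_ennreal less_imp_le)
    also have "\<dots> = (\<Sum>i\<in>UNIV. \<integral>\<^sup>+\<omega>. ennreal (h n \<omega> $ i) \<partial>M)"
      using h_measurable[of n] by (intro nn_integral_sum) measurable
    also have "\<dots> \<le> (\<Sum>i\<in>UNIV. ennreal (b i))"
      using b(2) by (intro sum_mono order_trans[OF SUP_upper b(2)]) simp
    also have "\<dots> = ennreal (\<Sum>i\<in>UNIV. b i)"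
      using b(1) by (simp add: sum_ennreal less_imp_le)
    finally show "(\<integral>\<^sup>+\<omega>. ennreal (\<Sum>i\<in>UNIV. h n \<omega> $ i) \<partial>M) \<le> ennreal (\<Sum>i\<in>UNIV. b i)" .
  next
    show "0 \<le> (\<Sum>i\<in>UNIV. b i)" using b(1) by (intro sum_nonneg) (simp add: less_imp_le)
  next
    fix n i show "AE \<omega> in M. h n \<omega> $ i \<le> h (Suc n) \<omega> $ i" using A3[of n i] by simp
  next
    fix n \<omega> assume \<omega>: "\<omega> \<in> space M"
    show "m \<omega> 0 = \<beta> 0 *\<^sub>R m_init + (1 - \<beta> 0) *\<^sub>R G (x 0 \<omega>) (\<xi> 0 \<omega>)"
      using path[OF \<omega>, of 0] by simp
    show "m \<omega> (Suc n) = \<beta> (Suc n) *\<^sub>R m \<omega> n + (1 - \<beta> (Suc n)) *\<^sub>R G (x (Suc n) \<omega>) (\<xi> (Suc n) \<omega>)"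
      using path[OF \<omega>, of "Suc n"] by simp
    show "diag_matrix (h n \<omega>) *v d \<omega> n = - ((1 / (1 - \<gamma> ^ (n + 1))) *\<^sub>R m \<omega> n)"
      using path[OF \<omega>, of n] by simp
    show "x (Suc n) \<omega> = metric_proj X (diag_matrix (h n \<omega>)) (x n \<omega> + \<alpha> n *\<^sub>R d \<omega> n)"
      using path[OF \<omega>, of n] by simp
    show "h 0 \<omega> = h0" "x 0 \<omega> = x0"
      using algorithm[OF \<omega>] by (simp_all add: algorithm_path_def)
  qed (rule prob_space_axioms assms(1) A1 D C2(1,2) K beta gamma h_pos h_measurable C1(2); assumption)+
  have grad_eq: "grad f = A.mean_grad"
    by (rule ext) (simp add: A.mean_grad_def C2(4))
  show ?thesis
  proof (intro conjI impI allI ballI)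
    fix y assume "y \<in> X"
    assume "(\<forall>n. 0 < \<alpha> n \<and> \<alpha> n < 1) \<and> filterlim (\<lambda>N. \<Sum>n<N. \<alpha> n) at_top sequentially \<and>
      summable (\<lambda>n. (\<alpha> n)\<^sup>2) \<and> summable (\<lambda>n. \<alpha> n * \<beta> n)"
    with \<open>y \<in> X\<close> show "limsup (\<lambda>n. ereal (\<integral>\<omega>. (y - x n \<omega>) \<bullet> grad f (x n \<omega>) \<partial>M)) \<ge> 0"
      unfolding grad_eq by (intro A.limsup_correlation_nonneg) auto
  next
    fix \<eta> lam :: real and y
    assume y: "y \<in> X"
    assume *: "1/2 \<le> \<eta> \<and> \<eta> < 1 \<and> 0 < lam \<and> lam < 1 \<and> 0 < \<alpha> 0 \<and> \<alpha> 0 < 1 \<and>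
      (\<forall>n\<ge>1. \<alpha> n = 1 / real n powr \<eta>) \<and> (\<forall>n\<ge>1. \<beta> n = lam ^ n)"
    have "\<exists>C. \<forall>n\<ge>1. - (C / real n powr (1 - \<eta>))
        \<le> 1 / real n * (\<Sum>k=1..n. \<integral>\<omega>. (y - x k \<omega>) \<bullet> A.mean_grad (x k \<omega>) \<partial>M)"
      by (rule A.average_correlation_rate[OF y, of \<eta> lam]) (use * in auto)
    then obtain C where C: "\<forall>n\<ge>1. - (C / real n powr (1 - \<eta>))
        \<le> 1 / real n * (\<Sum>k=1..n. \<integral>\<omega>. (y - x k \<omega>) \<bullet> A.mean_grad (x k \<omega>) \<partial>M)"
      by blast
    have "(\<lambda>n. C / real n powr (1 - \<eta>)) \<in> O(\<lambda>n. 1 / real n powr (1 - \<eta>))"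
      by (intro bigoI[of _ "\<bar>C\<bar>"] always_eventually) (simp add: abs_divide)
    then show "\<exists>r. r \<in> O(\<lambda>n. 1 / real n powr (1 - \<eta>)) \<and>
        (\<forall>n\<ge>1. 1 / real n * (\<Sum>k=1..n. \<integral>\<omega>. (y - x k \<omega>) \<bullet> grad f (x k \<omega>) \<partial>M) \<ge> - r n)"
      unfolding grad_eq using C by (intro exI[of _ "\<lambda>n. C / real n powr (1 - \<eta>)"]) auto
  qed
qed

end
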